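(* For the open Parke--Taylor variety one has $$\mathcal{I}(\mathrm{PT}^\circ_n)=\tilde{\mathcal{I}}(T_n)+\mathcal{L}\big(\psi^*(\tilde{\mathcal{I}}(V))\big).$$ For the closed Parke--Taylor variety one has $$\mathcal{I}(\mathrm{PT}_n)=\mathrm{num}\big(\mathcal{I}(\mathrm{PT}^\circ_n)\big):\Big(\prod_{\sigma\in\Sigma_n} z_\sigma\Big)^\infty ,$$ where $\mathrm{num}(\mathcal{I}(\mathrm{PT}_n^\circ))$ is the ideal in the polynomial ring $\mathbb{C}[z_\sigma:\sigma\in\Sigma_n]$ generated by the numerators of all elements of $\mathcal{I}(\mathrm{PT}^\circ_n)$.
   Context: $\Sigma_n$ is the set of permutations $\sigma$ of $[n]$ with $\sigma_1=1$, $\sigma_2=2$, and $z_\sigma$ ($\sigma\in\Sigma_n$) are the coordinates on $\mathbb{P}^{(n-2)!-1}$. Let $p_{ij}$ ($i<j$) be the coordinates on $\mathbb{P}^{\binom n2-1}$, with $p_{ji}=-p_{ij}$, and let $\tilde\varphi_n:\mathbb{P}^{\binom n2-1}\dashrightarrow\mathbb{P}^{(n-2)!-1}$ be the rational map given by $z_\sigma=\prod_{i=1}^n\frac{1}{p_{\sigma_i\sigma_{i+1}}}$, where $\sigma_{n+1}:=\sigma_1$. The toric variety $T_n$ is the Zariski closure of the image of $\tilde\varphi_n$. The open Parke--Taylor variety $\mathrm{PT}^\circ_n$ is the image under $\tilde\varphi_n$ of the Pl\"ucker-embedded Grassmannian $\mathrm{Gr}(2,n)\subset\mathbb{P}^{\binom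 n2-1}$ (where the map is defined), and the Parke--Taylor variety $\mathrm{PT}_n$ is its Zariski closure in $\mathbb{P}^{(n-2)!-1}$. $\mathcal{I}(\mathrm{PT}_n)$ is the vanishing ideal of $\mathrm{PT}_n$ in $\mathbb{C}[z_\sigma:\sigma\in\Sigma_n]$; $\mathcal{I}(\mathrm{PT}^\circ_n)$ and $\tilde{\mathcal{I}}(T_n)$ are the ideals of $\mathrm{PT}^\circ_n$ and of $T_n$ in the Laurent polynomial ring $\mathbb{C}[z_\sigma^{\pm}:\sigma\in\Sigma_n]$. $W\subset\mathbb{P}^{\binom n2-1}$ is the affine space defined by $p_{12}=1$ and $p_{in}=1$ for $i\in[n-1]$; its coordinates are $p_{ij}$ with $1\le i<j<n$, $(i,j)\neq(1,2)$. The open varieties $(\mathbb{C}^* )^{\binom{n-1}{2}-1}\subset W$ and $(\mathbb{C}^* )^{(n-2)!-1}\cap T_n$ are taken to be isomorphic via the map $\psi$ given by restricting $\tilde\varphi_n$, and $\psi^*:\mathbb{C}[p_{ij}^{\pm}:1\le i<j<n,\,(i,j)\ne(1,2)]\cong\mathbb{C}[z_\sigma^{\pm}:\sigma\in\Sigma_n]/\tilde{\mathcal{I}}(T_n)$ is the induced ring isomorphism. $V$ is the Zariski closure of $\mathcal{M}_{0,n}\subset W$, where $\mathcal{M}_{0,n}$ is the moduli space of $n$ distinct marked points on $\mathbb{P}^1$ up to projective transformations, realized as the set of points of $W\cap\mathrm{Gr}(2,n)$ with all $p_{ij}\ne0$; $\tilde{\mathcal{I}}(V)$ is its ideal in $\mathbb{C}[p_{ij}^{\pm}:1\le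 i<j<n,\,(i,j)\ne(1,2)]$. For an ideal $I$ of $\mathbb{C}[z_\sigma^{\pm}]/\tilde{\mathcal{I}}(T_n)$, $\mathcal{L}(I)$ is the ideal of $\mathbb{C}[z_\sigma^{\pm}]$ generated by preimages of the elements of $I$ under the projection $\mathbb{C}[z_\sigma^{\pm}]\to\mathbb{C}[z_\sigma^{\pm}]/\tilde{\mathcal{I}}(T_n)$ (a single preimage of each element suffices, since $\mathcal{L}(I)+\tilde{\mathcal{I}}(T_n)$ does not depend on the choice). For an ideal $I$ and an element $a$ of a commutative ring $S$, $I:a^\infty=\{r\in S:\exists N\ge0,\ ra^N\in I\}$.
   Formalization: The Laurent ideals in the z_σ are taken in the degree-0 Laurent polynomials, and ψ*(Ĩ(V)) means the preimage of Ĩ(V) under pullback along ψ, since ψ is not an isomorphism for n ≥ 4 (scaling the coordinates of W by t multiplies all z_σ by t^{-(n-3)}). *)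

theory Defs
  imports
    Complex_Main
    "HOL-Library.Poly_Mapping"
    "HOL-Combinatorics.Permutations"
    "HOL-Algebra.QuotRing"
begin

section \<open>Polynomial and Laurent polynomial rings\<close>

text \<open>
  A monomial is a finitely supported exponent function, with exponents in \<open>nat\<close> for polynomials
  and in \<open>int\<close> for Laurent polynomials; a (Laurent) polynomial is a finitely supported function
  from monomials to complex coefficients.  \<open>monoid_ring M\<close> is the monoid algebra of a submonoid
  \<open>M\<close> of monomials.
\<close>

type_synonym 'v mpoly = "('v \<Rightarrow>\<^sub>0 nat) \<Rightarrow>\<^sub>0 complex"
type_synonym 'v lpoly = "('v \<Rightarrow>\<^sub>0 int) \<Rightarrow>\<^sub>0 complex"

definition monoid_ring :: "'m::comm_monoid_add set \<Rightarrow> ('m \<Rightarrow>\<^sub>0 complex) ring" where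
  "monoid_ring M = \<lparr>carrier = {f. Poly_Mapping.keys f \<subseteq> M},
     mult = (*), one = 1, zero = 0, add = (+)\<rparr>"

definition poly_ring :: "'v set \<Rightarrow> ('v mpoly) ring" where
  "poly_ring A = monoid_ring {m. Poly_Mapping.keys m \<subseteq> A}"

definition laurent_ring :: "'v set \<Rightarrow> ('v lpoly) ring" where
  "laurent_ring A = monoid_ring {m. Poly_Mapping.keys m \<subseteq> A}"

text \<open>
  The ring of regular functions on the torus of the projective space with coordinates \<open>A\<close>: a
  Laurent polynomial in the homogeneous coordinates is a function on that torus, which has
  dimension \<open>card A - 1\<close>, only if all its terms have total degree 0.
\<close>

definition torus_ring :: "'v set \<Rightarrow> ('v lpoly) ring" where
  "torus_ring A = monoid_ring
     {m. Poly_Mapping.keys m \<subseteq> A \<and> (\<Sum>i\<in>Poly_Mapping.keys m. Poly_Mapping.lookup m i) = 0}"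

definition peval :: "('v \<Rightarrow> complex) \<Rightarrow> 'v mpoly \<Rightarrow> complex" where
  "peval v f = (\<Sum>m\<in>Poly_Mapping.keys f. Poly_Mapping.lookup f m *
     (\<Prod>i\<in>Poly_Mapping.keys m. v i ^ Poly_Mapping.lookup m i))"

definition leval :: "('v \<Rightarrow> complex) \<Rightarrow> 'v lpoly \<Rightarrow> complex" where
  "leval v f = (\<Sum>m\<in>Poly_Mapping.keys f. Poly_Mapping.lookup f m *
     (\<Prod>i\<in>Poly_Mapping.keys m. v i powi Poly_Mapping.lookup m i))"

definition homogeneous :: "'v mpoly \<Rightarrow> bool" where
  "homogeneous f \<longleftrightarrow> (\<exists>d. \<forall>m\<in>Poly_Mapping.keys f.
     (\<Sum>i\<in>Poly_Mapping.keys m. Poly_Mapping.lookup m i) = d)"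

definition pvar :: "'v \<Rightarrow> 'v mpoly" where
  "pvar i = Poly_Mapping.single (Poly_Mapping.single i 1) 1"

definition int_monom :: "('v \<Rightarrow>\<^sub>0 nat) \<Rightarrow> ('v \<Rightarrow>\<^sub>0 int)" where
  "int_monom m = Poly_Mapping.map int m"

definition laurent_of_poly :: "'v mpoly \<Rightarrow> 'v lpoly" where
  "laurent_of_poly g =
     (\<Sum>m\<in>Poly_Mapping.keys g. Poly_Mapping.single (int_monom m) (Poly_Mapping.lookup g m))"

text \<open>
  \<open>g\<close> is the numerator of the Laurent polynomial \<open>f\<close> when \<open>f = g / z^d\<close> in lowest terms, for a
  monomial \<open>z^d\<close>.
\<close>

definition is_numerator :: "'v lpoly \<Rightarrow> 'v mpoly \<Rightarrow> bool" where
  "is_numerator f g \<longleftrightarrow> (\<exists>d :: 'v \<Rightarrow>\<^sub>0 nat.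
     laurent_of_poly g = Poly_Mapping.single (int_monom d) 1 * f \<and>
     (\<forall>i\<in>Poly_Mapping.keys d. \<not> pvar i dvd g))"

definition num_ideal :: "'v set \<Rightarrow> 'v lpoly set \<Rightarrow> 'v mpoly set" where
  "num_ideal A I = Idl\<^bsub>poly_ring A\<^esub> {g. \<exists>f\<in>I. is_numerator f g}"

definition saturation :: "('a, 'b) ring_scheme \<Rightarrow> 'a set \<Rightarrow> 'a \<Rightarrow> 'a set" where
  "saturation S I a = {r \<in> carrier S. \<exists>N::nat. r \<otimes>\<^bsub>S\<^esub> (a [^]\<^bsub>S\<^esub> N) \<in> I}"

definition lift_ideal :: "('a, 'b) ring_scheme \<Rightarrow> 'a set \<Rightarrow> 'a set set \<Rightarrow> 'a set" where
  "lift_ideal S K I = Idl\<^bsub>S\<^esub> {f \<in> carrier S. K +>\<^bsub>S\<^esub> f \<in> I}"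

section \<open>Projective and affine varieties\<close>

text \<open>
  Coordinate vectors indexed by \<open>A\<close> are functions that vanish outside \<open>A\<close>; a point of projective
  space is the set of all its homogeneous coordinate vectors.
\<close>

definition vecs :: "'v set \<Rightarrow> ('v \<Rightarrow> complex) set" where
  "vecs A = {v. \<forall>i. i \<notin> A \<longrightarrow> v i = 0}"

definition proj_point :: "('v \<Rightarrow> complex) \<Rightarrow> ('v \<Rightarrow> complex) set" where
  "proj_point v = {(\<lambda>i. c * v i) | c. c \<noteq> 0}"

definition proj_space :: "'v set \<Rightarrow> ('v \<Rightarrow> complex) set set" where
  "proj_space A = proj_point ` (vecs A - {\<lambda>_. 0})"

definition proj_closed :: "'v set \<Rightarrow> ('v \<Rightarrow> complex) set set \<Rightarrow> bool" where
  "proj_closed A Z \<longleftrightarrow> (\<exists>F \<subseteq> {f \<in> carrier (poly_ring A). homogeneous f}.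
     Z = {P \<in> proj_space A. \<forall>v\<in>P. \<forall>f\<in>F. peval v f = 0})"

definition proj_closure :: "'v set \<Rightarrow> ('v \<Rightarrow> complex) set set \<Rightarrow> ('v \<Rightarrow> complex) set set" where
  "proj_closure A X = \<Inter>{Z. proj_closed A Z \<and> X \<subseteq> Z}"

definition vanishing_ideal :: "'v set \<Rightarrow> ('v \<Rightarrow> complex) set set \<Rightarrow> 'v mpoly set" where
  "vanishing_ideal A X = {f \<in> carrier (poly_ring A). \<forall>P\<in>X. \<forall>v\<in>P. peval v f = 0}"

definition torus_ideal :: "'v set \<Rightarrow> ('v \<Rightarrow> complex) set set \<Rightarrow> 'v lpoly set" where
  "torus_ideal A X = {f \<in> carrier (torus_ring A).
     \<forall>P\<in>X. \<forall>v\<in>P. (\<forall>i\<in>A. v i \<noteq> 0) \<longrightarrow> leval v f = 0}"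

section \<open>Parke--Taylor varieties\<close>

definition Sigma_perms :: "nat \<Rightarrow> (nat \<Rightarrow> nat) set" where
  "Sigma_perms n = {\<sigma>. \<sigma> permutes {1..n} \<and> \<sigma> 1 = 1 \<and> \<sigma> 2 = 2}"

definition pairs :: "nat \<Rightarrow> (nat \<times> nat) set" where
  "pairs n = {(i, j). 1 \<le> i \<and> i < j \<and> j \<le> n}"

definition skew :: "(nat \<times> nat \<Rightarrow> complex) \<Rightarrow> nat \<Rightarrow> nat \<Rightarrow> complex" where
  "skew p i j = (if i < j then p (i, j) else if j < i then - p (j, i) else 0)"

definition cyc_next :: "nat \<Rightarrow> nat \<Rightarrow> nat" where
  "cyc_next n i = (if i = n then 1 else i + 1)"

definition phi :: "nat \<Rightarrow> (nat \<times> nat \<Rightarrow> complex) \<Rightarrow> (nat \<Rightarrow> nat) \<Rightarrow> complex" where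
  "phi n p = (\<lambda>\<sigma>. if \<sigma> \<in> Sigma_perms n
     then \<Prod>i\<in>{1..n}. 1 / skew p (\<sigma> i) (\<sigma> (cyc_next n i)) else 0)"

definition phi_defined :: "nat \<Rightarrow> (nat \<times> nat \<Rightarrow> complex) \<Rightarrow> bool" where
  "phi_defined n p \<longleftrightarrow>
     (\<forall>\<sigma>\<in>Sigma_perms n. \<forall>i\<in>{1..n}. skew p (\<sigma> i) (\<sigma> (cyc_next n i)) \<noteq> 0)"

definition phi_image ::
    "nat \<Rightarrow> (nat \<times> nat \<Rightarrow> complex) set set \<Rightarrow> ((nat \<Rightarrow> nat) \<Rightarrow> complex) set set" where
  "phi_image n X = {proj_point (phi n p) | p P. P \<in> X \<and> p \<in> P \<and> phi_defined n p}"

definition Tvar :: "nat \<Rightarrow> ((nat \<Rightarrow> nat) \<Rightarrow> complex) set set" where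
  "Tvar n = proj_closure (Sigma_perms n) (phi_image n (proj_space (pairs n)))"

text \<open>
  The row span of the 2 by n matrix with rows \<open>x\<close>, \<open>y\<close> has the 2 by 2 minors as Pluecker
  coordinates; rank 2 means that they are not all 0.
\<close>

definition Gr2 :: "nat \<Rightarrow> (nat \<times> nat \<Rightarrow> complex) set set" where
  "Gr2 n = {proj_point p | p. p \<in> vecs (pairs n) - {\<lambda>_. 0} \<and>
     (\<exists>x y. \<forall>(i, j)\<in>pairs n. p (i, j) = x i * y j - x j * y i)}"

definition PT_open :: "nat \<Rightarrow> ((nat \<Rightarrow> nat) \<Rightarrow> complex) set set" where
  "PT_open n = phi_image n (Gr2 n)"

definition PT :: "nat \<Rightarrow> ((nat \<Rightarrow> nat) \<Rightarrow> complex) set set" where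
  "PT n = proj_closure (Sigma_perms n) (PT_open n)"

section \<open>The affine chart \<open>W\<close> and the pullback along \<open>\<psi>\<close>\<close>

definition Wpairs :: "nat \<Rightarrow> (nat \<times> nat) set" where
  "Wpairs n = {(i, j). 1 \<le> i \<and> i < j \<and> j < n \<and> (i, j) \<noteq> (1, 2)}"

definition Wspace :: "nat \<Rightarrow> (nat \<times> nat \<Rightarrow> complex) set" where
  "Wspace n = {p \<in> vecs (pairs n). p (1, 2) = 1 \<and> (\<forall>i\<in>{1..n-1}. p (i, n) = 1)}"

definition M0 :: "nat \<Rightarrow> (nat \<times> nat \<Rightarrow> complex) set" where
  "M0 n = {p \<in> Wspace n. proj_point p \<in> Gr2 n \<and> (\<forall>e\<in>pairs n. p e \<noteq> 0)}"

definition W_closed :: "nat \<Rightarrow> (nat \<times> nat \<Rightarrow> complex) set \<Rightarrow> bool" where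
  "W_closed n Z \<longleftrightarrow> (\<exists>F \<subseteq> carrier (poly_ring (Wpairs n)).
     Z = {p \<in> Wspace n. \<forall>f\<in>F. peval p f = 0})"

definition Vvar :: "nat \<Rightarrow> (nat \<times> nat \<Rightarrow> complex) set" where
  "Vvar n = \<Inter>{Z. W_closed n Z \<and> M0 n \<subseteq> Z}"

definition V_ideal :: "nat \<Rightarrow> (nat \<times> nat) lpoly set" where
  "V_ideal n = {f \<in> carrier (laurent_ring (Wpairs n)).
     \<forall>p\<in>Vvar n. (\<forall>e\<in>Wpairs n. p e \<noteq> 0) \<longrightarrow> leval p f = 0}"

text \<open>
  The \<open>k\<close>-th power of the coordinate function \<open>p\<^sub>i\<^sub>j\<close> (\<open>i \<noteq> j\<close>) on \<open>W\<close>, where \<open>p\<^sub>j\<^sub>i = - p\<^sub>i\<^sub>j\<close> and the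
  coordinates outside \<open>Wpairs n\<close> are 1.
\<close>

definition W_coord_pow :: "nat \<Rightarrow> nat \<Rightarrow> nat \<Rightarrow> int \<Rightarrow> (nat \<times> nat) lpoly" where
  "W_coord_pow n i j k =
     Poly_Mapping.single
       (if (min i j, max i j) \<in> Wpairs n then Poly_Mapping.single (min i j, max i j) k else 0)
       (if i < j then 1 else (- 1) powi k)"

definition psi_subst :: "nat \<Rightarrow> (nat \<Rightarrow> nat) lpoly \<Rightarrow> (nat \<times> nat) lpoly" where
  "psi_subst n f = (\<Sum>m\<in>Poly_Mapping.keys f. Poly_Mapping.single 0 (Poly_Mapping.lookup f m) *
     (\<Prod>\<sigma>\<in>Poly_Mapping.keys m. \<Prod>i\<in>{1..n}.
        W_coord_pow n (\<sigma> i) (\<sigma> (cyc_next n i)) (- Poly_Mapping.lookup m \<sigma>)))"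

abbreviation z_ring :: "nat \<Rightarrow> ((nat \<Rightarrow> nat) lpoly) ring" where
  "z_ring n \<equiv> torus_ring (Sigma_perms n)"

abbreviation T_ideal :: "nat \<Rightarrow> (nat \<Rightarrow> nat) lpoly set" where
  "T_ideal n \<equiv> torus_ideal (Sigma_perms n) (Tvar n)"

text \<open>
  The pullback along \<open>\<psi>\<close>, from the coordinate ring of the torus of \<open>T\<^sub>n\<close> to that of the torus
  of \<open>W\<close>.
\<close>

definition psi_pullback :: "nat \<Rightarrow> (nat \<Rightarrow> nat) lpoly set \<Rightarrow> (nat \<times> nat) lpoly" where
  "psi_pullback n X = the_elem (psi_subst n ` X)"

text \<open>
  \<open>\<psi>\<^sup>*\<close>, going from functions in the \<open>p\<^sub>i\<^sub>j\<close> to functions in the \<open>z\<^sub>\<sigma>\<close>, is the inverse of the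
  pullback along \<open>\<psi>\<close>.  Its effect on an ideal \<open>J\<close> is defined here as the preimage of \<open>J\<close> under the
  pullback, so that no bijectivity has to be assumed: \<open>\<psi>\<close> is not injective for \<open>n \<ge> 4\<close>, since
  rescaling all the coordinates in \<open>Wpairs n\<close> by a common factor multiplies every \<open>z\<^sub>\<sigma>\<close> by the same
  number.  Where the pullback is bijective, this is the image of \<open>J\<close> under the inverse, by the
  lemma below.
\<close>

definition psi_star :: "nat \<Rightarrow> (nat \<times> nat) lpoly set \<Rightarrow> (nat \<Rightarrow> nat) lpoly set set" where
  "psi_star n J = {X \<in> carrier (z_ring n Quot T_ideal n). psi_pullback n X \<in> J}"

lemma psi_star_eq_image_inverse:
  assumes "bij_betw (psi_pullback n) (carrier (z_ring n Quot T_ideal n))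
             (carrier (laurent_ring (Wpairs n)))"
    and "J \<subseteq> carrier (laurent_ring (Wpairs n))"
  shows "psi_star n J = inv_into (carrier (z_ring n Quot T_ideal n)) (psi_pullback n) ` J"
proof (intro equalityI subsetI)
  fix X assume "X \<in> psi_star n J"
  then have "X \<in> carrier (z_ring n Quot T_ideal n)" and "psi_pullback n X \<in> J"
    by (auto simp: psi_star_def)
  then show "X \<in> inv_into (carrier (z_ring n Quot T_ideal n)) (psi_pullback n) ` J"
    using bij_betw_inv_into_left[OF assms(1)] by (metis imageI)
next
  fix X assume "X \<in> inv_into (carrier (z_ring n Quot T_ideal n)) (psi_pullback n) ` J"
  then obtain g where g: "g \<in> J"
    "X = inv_into (carrier (z_ring n Quot T_ideal n)) (psi_pullback n) g"
    by blast
  with assms(2) have "g \<in> carrier (laurent_ring (Wpairs n))" by blast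
  then show "X \<in> psi_star n J"
    using g bij_betw_inv_into_right[OF assms(1)] bij_betwE[OF bij_betw_inv_into[OF assms(1)]]
    by (auto simp: psi_star_def)
qed

section \<open>The rings above are commutative rings\<close>

lemma cring_monoid_ring:
  assumes M0: "0 \<in> M" and Madd: "\<And>a b. a \<in> M \<Longrightarrow> b \<in> M \<Longrightarrow> a + b \<in> M"
  shows "cring (monoid_ring M)"
proof (rule cringI)
  have add: "f + g \<in> carrier (monoid_ring M)"
    if "f \<in> carrier (monoid_ring M)" "g \<in> carrier (monoid_ring M)" for f g
    using that Poly_Mapping.keys_add[of f g] by (auto simp: monoid_ring_def)
  have mult: "f * g \<in> carrier (monoid_ring M)"
    if "f \<in> carrier (monoid_ring M)" "g \<in> carrier (monoid_ring M)" for f g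
    using that keys_mult[of f g] Madd by (fastforce simp: monoid_ring_def)
  show "abelian_group (monoid_ring M)"
  proof (rule abelian_groupI)
    fix f assume f: "f \<in> carrier (monoid_ring M)"
    then have "- f \<in> carrier (monoid_ring M)"
      by (auto simp: monoid_ring_def in_keys_iff)
    then show "\<exists>y\<in>carrier (monoid_ring M). y \<oplus>\<^bsub>monoid_ring M\<^esub> f = \<zero>\<^bsub>monoid_ring M\<^esub>"
      by (intro bexI[of _ "- f"]) (auto simp: monoid_ring_def)
  next
    fix f g assume "f \<in> carrier (monoid_ring M)" "g \<in> carrier (monoid_ring M)"
    then show "f \<oplus>\<^bsub>monoid_ring M\<^esub> g \<in> carrier (monoid_ring M)"
      using add by (simp add: monoid_ring_def)
  qed (auto simp: monoid_ring_def algebra_simps)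
  show "comm_monoid (monoid_ring M)"
  proof (rule comm_monoidI)
    fix f g assume "f \<in> carrier (monoid_ring M)" "g \<in> carrier (monoid_ring M)"
    then show "f \<otimes>\<^bsub>monoid_ring M\<^esub> g \<in> carrier (monoid_ring M)"
      using mult by (simp add: monoid_ring_def)
  qed (use M0 in \<open>auto simp: monoid_ring_def algebra_simps\<close>)
qed (auto simp: monoid_ring_def algebra_simps)

lemma cring_poly_ring: "cring (poly_ring A)"
  unfolding poly_ring_def
proof (rule cring_monoid_ring)
  fix a b :: "'a \<Rightarrow>\<^sub>0 nat"
  assume "a \<in> {m. Poly_Mapping.keys m \<subseteq> A}" "b \<in> {m. Poly_Mapping.keys m \<subseteq> A}"
  then show "a + b \<in> {m. Poly_Mapping.keys m \<subseteq> A}"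
    using Poly_Mapping.keys_add[of a b] by auto
qed simp

lemma cring_laurent_ring: "cring (laurent_ring A)"
  unfolding laurent_ring_def
proof (rule cring_monoid_ring)
  fix a b :: "'a \<Rightarrow>\<^sub>0 int"
  assume "a \<in> {m. Poly_Mapping.keys m \<subseteq> A}" "b \<in> {m. Poly_Mapping.keys m \<subseteq> A}"
  then show "a + b \<in> {m. Poly_Mapping.keys m \<subseteq> A}"
    using Poly_Mapping.keys_add[of a b] by auto
qed simp

lemma cring_torus_ring: "cring (torus_ring A)"
  unfolding torus_ring_def
proof (rule cring_monoid_ring)
  fix a b :: "'a \<Rightarrow>\<^sub>0 int"
  let ?s = "\<lambda>m::'a \<Rightarrow>\<^sub>0 int. \<Sum>i\<in>Poly_Mapping.keys m. Poly_Mapping.lookup m i"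
  assume ab: "a \<in> {m. Poly_Mapping.keys m \<subseteq> A \<and> ?s m = 0}"
    "b \<in> {m. Poly_Mapping.keys m \<subseteq> A \<and> ?s m = 0}"
  have "?s (a + b) = ?s a + ?s b"
  proof -
    let ?K = "Poly_Mapping.keys a \<union> Poly_Mapping.keys b"
    have ext: "?s m = (\<Sum>i\<in>?K. Poly_Mapping.lookup m i)" if "Poly_Mapping.keys m \<subseteq> ?K" for m
      using that by (intro sum.mono_neutral_left) (auto simp: in_keys_iff)
    have "?s (a + b) = (\<Sum>i\<in>?K. Poly_Mapping.lookup (a + b) i)"
      by (rule ext[OF Poly_Mapping.keys_add])
    also have "\<dots> = (\<Sum>i\<in>?K. Poly_Mapping.lookup a i) + (\<Sum>i\<in>?K. Poly_Mapping.lookup b i)"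
      by (simp only: lookup_add sum.distrib)
    also have "\<dots> = ?s a + ?s b"
      using ext[of a] ext[of b] by simp
    finally show ?thesis .
  qed
  then show "a + b \<in> {m. Poly_Mapping.keys m \<subseteq> A \<and> ?s m = 0}"
    using ab Poly_Mapping.keys_add[of a b] by auto
qed simp

section \<open>\<open>psi_subst\<close> is composition with \<open>\<psi>\<close>\<close>

definition monom_eval :: "('v \<Rightarrow> complex) \<Rightarrow> ('v \<Rightarrow>\<^sub>0 int) \<Rightarrow> complex" where
 "monom_eval v m = (\<Prod>i\<in>Poly_Mapping.keys m. v i powi Poly_Mapping.lookup m i)"

lemma monom_eval_ext: assumes "finite K" "Poly_Mapping.keys m \<subseteq> K" 
  shows "monom_eval v m = (\<Prod>i\<in>K. v i powi Poly_Mapping.lookup m i)"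
  unfolding monom_eval_def using assms by (intro prod.mono_neutral_left) (auto simp: in_keys_iff)

lemma monom_eval_add:
  assumes "\<And>i. i \<in> Poly_Mapping.keys a \<union> Poly_Mapping.keys b \<Longrightarrow> v i \<noteq> 0"
  shows "monom_eval v (a+b) = monom_eval v a * monom_eval v b"
proof -
  let ?K = "Poly_Mapping.keys a \<union> Poly_Mapping.keys b"
  have "monom_eval v (a+b) = (\<Prod>i\<in>?K. v i powi Poly_Mapping.lookup (a+b) i)"
    by (rule monom_eval_ext) (auto simp: Poly_Mapping.keys_add)
  also have "\<dots> = (\<Prod>i\<in>?K. v i powi Poly_Mapping.lookup a i * v i powi Poly_Mapping.lookup b i)"
    by (intro prod.cong refl) (simp only: lookup_add, use assms in \<open>simp add: power_int_add\<close>)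
  also have "\<dots> = monom_eval v a * monom_eval v b"
    by (simp add: prod.distrib monom_eval_ext[of ?K])
  finally show ?thesis .
qed

lemma monom_eval_sum:
  assumes "finite S" "\<And>s i. s \<in> S \<Longrightarrow> i \<in> Poly_Mapping.keys (e s) \<Longrightarrow> v i \<noteq> 0"
  shows "monom_eval v (sum e S) = (\<Prod>s\<in>S. monom_eval v (e s)) \<and> (\<forall>i\<in>Poly_Mapping.keys (sum e S). v i \<noteq> 0)"
  using assms
proof (induction S rule: finite_induct)
  case empty then show ?case by (simp add: monom_eval_def)
next
  case (insert x F)
  then have IH: "monom_eval v (sum e F) = (\<Prod>s\<in>F. monom_eval v (e s))" "\<forall>i\<in>Poly_Mapping.keys (sum e F). v i \<noteq> 0"
    by auto
  have x: "\<And>i. i \<in> Poly_Mapping.keys (e x) \<Longrightarrow> v i \<noteq> 0" using insert by auto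
  have "monom_eval v (e x + sum e F) = monom_eval v (e x) * monom_eval v (sum e F)" using IH x by (intro monom_eval_add) auto
  moreover have "\<forall>i\<in>Poly_Mapping.keys (e x + sum e F). v i \<noteq> 0"
    using IH x Poly_Mapping.keys_add[of "e x" "sum e F"] by auto
  ultimately show ?case using insert IH by simp
qed

lemma leval_ext: assumes "finite K" "Poly_Mapping.keys f \<subseteq> K"
  shows "leval v f = (\<Sum>m\<in>K. Poly_Mapping.lookup f m * monom_eval v m)"
  unfolding leval_def monom_eval_def using assms by (intro sum.mono_neutral_left) (auto simp: in_keys_iff)

lemma leval_add: "leval v (f+g) = leval v f + leval v g"
proof -
  let ?K = "Poly_Mapping.keys f \<union> Poly_Mapping.keys g"
  have "leval v (f+g) = (\<Sum>m\<in>?K. Poly_Mapping.lookup (f+g) m * monom_eval v m)"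
    by (rule leval_ext) (auto simp: Poly_Mapping.keys_add)
  also have "\<dots> = (\<Sum>m\<in>?K. Poly_Mapping.lookup f m * monom_eval v m) + (\<Sum>m\<in>?K. Poly_Mapping.lookup g m * monom_eval v m)"
    by (simp only: lookup_add distrib_right sum.distrib)
  also have "\<dots> = leval v f + leval v g" by (simp add: leval_ext[of ?K])
  finally show ?thesis .
qed

lemma leval_sum: "finite S \<Longrightarrow> leval v (sum f S) = (\<Sum>s\<in>S. leval v (f s))"
  by (induction S rule: finite_induct) (auto simp: leval_add, simp add: leval_def)

lemma leval_single: "leval v (Poly_Mapping.single e c) = c * monom_eval v e"
  by (cases "c = 0") (auto simp: leval_def monom_eval_def)

lemma prod_single: "finite S \<Longrightarrow> (\<Prod>s\<in>S. Poly_Mapping.single (e s) (c s :: complex)) = Poly_Mapping.single (sum e S) (prod c S)"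
  by (induction S rule: finite_induct) (auto simp: mult_single)

lemma prod_powi: "finite S \<Longrightarrow> (\<Prod>s\<in>S. f s powi k) = (\<Prod>s\<in>S. f s :: complex) powi k"
  by (induction S rule: finite_induct) (auto simp: power_int_mult_distrib)

lemma pwsign: "(-1::complex) powi k * (x powi k) = (-x) powi k"
  using power_int_mult_distrib[of "-1::complex" x k] by simp

lemma leval_psi_subst:
  assumes n: "n \<ge> 3" and p: "p \<in> Wspace n" "\<forall>e\<in>pairs n. p e \<noteq> 0" 
    and f: "f \<in> carrier (z_ring n)"
  shows "leval p (psi_subst n f) = leval (phi n p) f"
proof -
  have W0: "\<And>e. e \<in> Wpairs n \<Longrightarrow> p e \<noteq> 0" using p by (auto simp: Wpairs_def pairs_def)
  define ex where "ex i j k = (if (min i j, max i j) \<in> Wpairs n then Poly_Mapping.single (min i j, max i j) k else 0)" for i j and k :: int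
  define sg where "sg i j k = (if i < j then 1 else (- 1 :: complex) powi k)" for i j :: nat and k :: int
  have ex0: "\<And>i j k e. e \<in> Poly_Mapping.keys (ex i j k) \<Longrightarrow> p e \<noteq> 0"
    using W0 by (auto simp: ex_def split: if_splits)
  have mx: "sg i j k * monom_eval p (ex i j k) = skew p i j powi k"
    if ij: "i \<in> {1..n}" "j \<in> {1..n}" "i \<noteq> j" for i j k
  proof -
    have m1: "monom_eval p (ex i j k) = p (min i j, max i j) powi k"
    proof (cases "(min i j, max i j) \<in> Wpairs n")
      case True then show ?thesis by (cases "k = 0") (auto simp: ex_def monom_eval_def)
    next
      case False
      then have "(min i j, max i j) = (1,2) \<or> max i j = n \<and> min i j \<in> {1..n-1}"
        using ij by (auto simp: Wpairs_def min_def max_def)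
      then have "p (min i j, max i j) = 1" using p by (auto simp: Wspace_def)
      with False show ?thesis by (auto simp: ex_def monom_eval_def)
    qed
    show ?thesis
      using ij unfolding m1 by (auto simp: sg_def skew_def pwsign min_def max_def)
  qed
  have trm: "leval p (Poly_Mapping.single 0 (Poly_Mapping.lookup f m) *
     (\<Prod>\<sigma>\<in>Poly_Mapping.keys m. \<Prod>i\<in>{1..n}.
        W_coord_pow n (\<sigma> i) (\<sigma> (cyc_next n i)) (- Poly_Mapping.lookup m \<sigma>)))
     = Poly_Mapping.lookup f m * monom_eval (phi n p) m" if m: "m \<in> Poly_Mapping.keys f" for m
  proof -
    have mS: "Poly_Mapping.keys m \<subseteq> Sigma_perms n" using f m by (auto simp: torus_ring_def monoid_ring_def)
    let ?e = "\<lambda>\<sigma> i. ex (\<sigma> i) (\<sigma> (cyc_next n i)) (- Poly_Mapping.lookup m \<sigma>)"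
    let ?c = "\<lambda>\<sigma> i. sg (\<sigma> i) (\<sigma> (cyc_next n i)) (- Poly_Mapping.lookup m \<sigma>)"
    have W: "W_coord_pow n i j k = Poly_Mapping.single (ex i j k) (sg i j k)" for i j k
      by (simp only: W_coord_pow_def ex_def sg_def)
    have P: "(\<Prod>\<sigma>\<in>Poly_Mapping.keys m. \<Prod>i\<in>{1..n}.
        W_coord_pow n (\<sigma> i) (\<sigma> (cyc_next n i)) (- Poly_Mapping.lookup m \<sigma>))
      = Poly_Mapping.single (\<Sum>\<sigma>\<in>Poly_Mapping.keys m. \<Sum>i\<in>{1..n}. ?e \<sigma> i)
         (\<Prod>\<sigma>\<in>Poly_Mapping.keys m. \<Prod>i\<in>{1..n}. ?c \<sigma> i)"
      by (simp only: W prod_single finite_atLeastAtMost finite_keys)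
    have s1: "monom_eval p (\<Sum>i\<in>{1..n}. ?e \<sigma> i) = (\<Prod>i\<in>{1..n}. monom_eval p (?e \<sigma> i)) \<and> (\<forall>i\<in>Poly_Mapping.keys (\<Sum>i\<in>{1..n}. ?e \<sigma> i). p i \<noteq> 0)" for \<sigma>
      by (rule monom_eval_sum) (use ex0 in auto)
    have s2: "monom_eval p (\<Sum>\<sigma>\<in>Poly_Mapping.keys m. \<Sum>i\<in>{1..n}. ?e \<sigma> i) = (\<Prod>\<sigma>\<in>Poly_Mapping.keys m. monom_eval p (\<Sum>i\<in>{1..n}. ?e \<sigma> i))"
      using monom_eval_sum[of "Poly_Mapping.keys m" "\<lambda>\<sigma>. \<Sum>i\<in>{1..n}. ?e \<sigma> i" p] s1 by auto
    have "(\<Prod>\<sigma>\<in>Poly_Mapping.keys m. \<Prod>i\<in>{1..n}. ?c \<sigma> i) * monom_eval p (\<Sum>\<sigma>\<in>Poly_Mapping.keys m. \<Sum>i\<in>{1..n}. ?e \<sigma> i)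
      = (\<Prod>\<sigma>\<in>Poly_Mapping.keys m. \<Prod>i\<in>{1..n}. ?c \<sigma> i * monom_eval p (?e \<sigma> i))"
      unfolding s2 by (simp only: s1 prod.distrib)
    also have "\<dots> = (\<Prod>\<sigma>\<in>Poly_Mapping.keys m. phi n p \<sigma> powi Poly_Mapping.lookup m \<sigma>)"
    proof (rule prod.cong[OF refl])
      fix \<sigma> assume "\<sigma> \<in> Poly_Mapping.keys m"
      then have s: "\<sigma> \<in> Sigma_perms n" using mS by auto
      then have perm: "\<sigma> permutes {1..n}" by (simp add: Sigma_perms_def)
      have "(\<Prod>i\<in>{1..n}. ?c \<sigma> i * monom_eval p (?e \<sigma> i)) = (\<Prod>i\<in>{1..n}. (1 / skew p (\<sigma> i) (\<sigma> (cyc_next n i))) powi Poly_Mapping.lookup m \<sigma>)"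
      proof (rule prod.cong[OF refl])
        fix i assume i: "i \<in> {1..n}"
        have c: "cyc_next n i \<in> {1..n}" "cyc_next n i \<noteq> i" using i n by (auto simp: cyc_next_def)
        have "\<sigma> i \<in> {1..n}" "\<sigma> (cyc_next n i) \<in> {1..n}" 
          using permutes_in_image[OF perm] i c by auto
        moreover have "\<sigma> i \<noteq> \<sigma> (cyc_next n i)" using permutes_inj[OF perm] c by (metis injD)
        ultimately show "?c \<sigma> i * monom_eval p (?e \<sigma> i) = (1 / skew p (\<sigma> i) (\<sigma> (cyc_next n i))) powi Poly_Mapping.lookup m \<sigma>"
          using mx[of "\<sigma> i" "\<sigma> (cyc_next n i)" "- Poly_Mapping.lookup m \<sigma>"]
            by (simp add: power_int_minus power_int_inverse divide_inverse)
      qed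
      also have "\<dots> = (\<Prod>i\<in>{1..n}. 1 / skew p (\<sigma> i) (\<sigma> (cyc_next n i))) powi Poly_Mapping.lookup m \<sigma>"
        by (simp only: prod_powi finite_atLeastAtMost)
      also have "\<dots> = phi n p \<sigma> powi Poly_Mapping.lookup m \<sigma>" using s by (simp add: phi_def)
      finally show "(\<Prod>i\<in>{1..n}. ?c \<sigma> i * monom_eval p (?e \<sigma> i)) = phi n p \<sigma> powi Poly_Mapping.lookup m \<sigma>" .
    qed
    finally show ?thesis unfolding P by (simp add: mult_single leval_single monom_eval_def)
  qed
  have "leval p (psi_subst n f) = (\<Sum>m\<in>Poly_Mapping.keys f. Poly_Mapping.lookup f m * monom_eval (phi n p) m)"
    unfolding psi_subst_def by (subst leval_sum) (auto simp only: finite_keys trm intro!: sum.cong)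
  also have "\<dots> = leval (phi n p) f" by (simp add: leval_def monom_eval_def)
  finally show ?thesis .
qed

end

theory Submission
  imports Defs
begin

text \<open>
  Both identities come from describing the ideal \<open>I\<close> of the open Parke--Taylor variety in the ring of
  Laurent polynomials of degree 0 by evaluation at torus points.

  Every point of the Grassmannian with nonzero Pluecker coordinates can be rescaled, by
  \<open>p\<^sub>i\<^sub>j \<mapsto> c t\<^sub>i t\<^sub>j p\<^sub>i\<^sub>j\<close>, to a point of the moduli space inside the chart \<open>W\<close>
  (\<open>Gr2_rescale_M0\<close>), and this does not change the image point, since every index occurs in exactly
  two factors of a Parke--Taylor product (\<open>phi_rescale\<close>).  Hence a function lies in \<open>I\<close> if and only
  if its pullback to \<open>W\<close> vanishes on the moduli space, which means that the pullback lies in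
  \<open>V_ideal\<close> (\<open>torus_ideal_PT_open\<close>).  The functions that vanish on the toric variety pull back to
  0, because a Laurent polynomial that vanishes on the whole torus is 0
  (\<open>independent_monom_eval\<close>, \<open>psi_subst_T_ideal\<close>).  So the pullback is well defined on
  cosets, and \<open>lift_ideal\<close> applied to the preimage of \<open>V_ideal\<close> is \<open>I\<close>.  As \<open>I\<close> contains the
  ideal of the toric variety, adding that ideal changes nothing.  Neither injectivity nor
  surjectivity of the pullback is needed.

  The second identity holds for every set \<open>X\<close> of points of the torus of a projective space with
  finitely many coordinates (\<open>vanishing_ideal_proj_closure_eq_saturation\<close>).  The ideal of the
  closure of \<open>X\<close> is spanned by the forms \<open>h\<close> that vanish on \<open>X\<close>.  If \<open>h\<close> has degree \<open>k\<close>, then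
  \<open>h / z\<^sub>a\<^sup>k\<close> is a function on the torus that vanishes on \<open>X\<close>, and \<open>h\<close> is a monomial multiple of
  its numerator (\<open>numerator_exists\<close>).  Conversely, all numerators vanish on \<open>X\<close>, and the product of
  the coordinates has no zeros on \<open>X\<close>.
\<close>

abbreviation lookup :: "('a \<Rightarrow>\<^sub>0 'b::zero) \<Rightarrow> 'a \<Rightarrow> 'b" where
  "lookup \<equiv> Poly_Mapping.lookup"

abbreviation keys :: "('a \<Rightarrow>\<^sub>0 'b::zero) \<Rightarrow> 'a set" where
  "keys \<equiv> Poly_Mapping.keys"

abbreviation single :: "'a \<Rightarrow> 'b::zero \<Rightarrow> 'a \<Rightarrow>\<^sub>0 'b" where
  "single \<equiv> Poly_Mapping.single"

section \<open>Monomials, degrees and evaluation\<close>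

lemma lookup_int_monom [simp]: "lookup (int_monom m) i = int (lookup m i)"
  by (simp add: int_monom_def map.rep_eq when_def)

lemma keys_int_monom [simp]: "keys (int_monom m) = keys m"
  by (auto simp: in_keys_iff)

lemma int_monom_add: "int_monom (a + b) = int_monom a + int_monom b"
  by (rule poly_mapping_eqI) (simp add: lookup_add)

lemma int_monom_eq_iff [simp]: "int_monom a = int_monom b \<longleftrightarrow> a = b"
  by (metis lookup_int_monom of_nat_eq_iff poly_mapping_eqI)

lemma int_monom_single [simp]: "int_monom (single i k) = single i (int k)"
  by (rule poly_mapping_eqI) (simp add: lookup_single when_def)

text \<open>
  The inverse of \<open>int_monom\<close> on monomials without negative exponents; negative exponents are
  replaced by 0.
\<close>

definition nat_monom :: "('v \<Rightarrow>\<^sub>0 int) \<Rightarrow> ('v \<Rightarrow>\<^sub>0 nat)" where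
  "nat_monom m = Poly_Mapping.map nat m"

lemma lookup_nat_monom [simp]: "lookup (nat_monom m) i = nat (lookup m i)"
  by (simp add: nat_monom_def map.rep_eq when_def)

lemma int_monom_nat_monom: "(\<And>i. lookup m i \<ge> 0) \<Longrightarrow> int_monom (nat_monom m) = m"
  by (rule poly_mapping_eqI) simp

text \<open>The total degree of a monomial, with exponents in \<open>nat\<close> or in \<open>int\<close>.\<close>

definition mdeg :: "('v \<Rightarrow>\<^sub>0 'a::comm_monoid_add) \<Rightarrow> 'a" where
  "mdeg m = (\<Sum>i\<in>keys m. lookup m i)"

lemma mdeg_superset: "finite K \<Longrightarrow> keys m \<subseteq> K \<Longrightarrow> mdeg m = (\<Sum>i\<in>K. lookup m i)"
  unfolding mdeg_def by (intro sum.mono_neutral_left) (auto simp: in_keys_iff)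

lemma mdeg_add: "mdeg (a + b) = mdeg a + mdeg b"
proof -
  let ?K = "keys a \<union> keys b"
  have "mdeg (a + b) = (\<Sum>i\<in>?K. lookup (a + b) i)"
    by (rule mdeg_superset) (auto simp: Poly_Mapping.keys_add)
  also have "\<dots> = mdeg a + mdeg b"
    by (simp add: lookup_add sum.distrib mdeg_superset[of ?K])
  finally show ?thesis .
qed

lemma mdeg_int_monom [simp]: "mdeg (int_monom m) = int (mdeg m)"
  by (simp add: mdeg_def)

lemma mdeg_single [simp]: "mdeg (single i k) = k"
  by (simp add: mdeg_def)

lemma carrier_poly_ring: "carrier (poly_ring A) = {f. \<forall>m\<in>keys f. keys m \<subseteq> A}"
  by (auto simp: poly_ring_def monoid_ring_def)

lemma carrier_laurent_ring: "carrier (laurent_ring A) = {f. \<forall>m\<in>keys f. keys m \<subseteq> A}"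
  by (auto simp: laurent_ring_def monoid_ring_def)

lemma carrier_torus_ring:
  "carrier (torus_ring A) = {f. \<forall>m\<in>keys f. keys m \<subseteq> A \<and> mdeg m = 0}"
  by (auto simp: torus_ring_def monoid_ring_def mdeg_def)

lemma homogeneous_iff: "homogeneous f \<longleftrightarrow> (\<exists>d. \<forall>m\<in>keys f. mdeg m = d)"
  by (simp add: homogeneous_def mdeg_def)

lemma poly_mapping_sum_single: "f = (\<Sum>m\<in>keys f. single m (lookup f m))"
  by (rule poly_mapping_eqI) (auto simp: lookup_sum lookup_single when_def in_keys_iff sum.delta')

lemma times_poly_mapping_sum:
  "f * g = (\<Sum>a\<in>keys f. \<Sum>b\<in>keys g. single (a + b) (lookup f a * lookup g b :: complex))"
proof -
  have "f * g = (\<Sum>a\<in>keys f. single a (lookup f a)) * (\<Sum>b\<in>keys g. single b (lookup g b))"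
    by (simp only: poly_mapping_sum_single[symmetric])
  then show ?thesis
    by (simp only: sum_product mult_single)
qed

lemma keys_prod_subset:
  assumes "0 \<in> M" "\<And>a b. a \<in> M \<Longrightarrow> b \<in> M \<Longrightarrow> a + b \<in> M"
    and "\<And>s. s \<in> S \<Longrightarrow> keys (f s :: _ \<Rightarrow>\<^sub>0 complex) \<subseteq> M"
  shows "keys (\<Prod>s\<in>S. f s) \<subseteq> M"
  using assms(3)
proof (induction S rule: infinite_finite_induct)
  case (insert s S)
  then have *: "keys (f s) \<subseteq> M" "keys (\<Prod>s\<in>S. f s) \<subseteq> M" by auto
  have "keys (f s * (\<Prod>s\<in>S. f s)) \<subseteq> M"
  proof
    fix x assume "x \<in> keys (f s * (\<Prod>s\<in>S. f s))"
    then obtain a b where "x = a + b" "a \<in> keys (f s)" "b \<in> keys (\<Prod>s\<in>S. f s)"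
      using keys_mult by blast
    with * assms(2) show "x \<in> M" by blast
  qed
  with insert.hyps show ?case by simp
qed (use assms(1) in auto)

lemma powi_sum: "c \<noteq> 0 \<Longrightarrow> (c::complex) powi (\<Sum>i\<in>S. k i) = (\<Prod>i\<in>S. c powi k i)"
  by (induction S rule: infinite_finite_induct) (auto simp: power_int_add)

lemma monom_eval_scale:
  "c \<noteq> 0 \<Longrightarrow> monom_eval (\<lambda>i. c * v i) m = c powi mdeg m * monom_eval v m"
  by (simp add: monom_eval_def mdeg_def powi_sum power_int_mult_distrib prod.distrib)

lemma monom_eval_nonzero: "(\<And>i. i \<in> keys m \<Longrightarrow> v i \<noteq> 0) \<Longrightarrow> monom_eval v m \<noteq> 0"
  by (simp add: monom_eval_def)

lemma monom_eval_cong: "(\<And>i. i \<in> keys m \<Longrightarrow> v i = w i) \<Longrightarrow> monom_eval v m = monom_eval w m"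
  by (simp add: monom_eval_def)

lemma monom_eval_single [simp]: "monom_eval v (single i k) = v i powi k"
  by (auto simp: monom_eval_def)

lemma leval_monom_eval: "leval v f = (\<Sum>m\<in>keys f. lookup f m * monom_eval v m)"
  by (simp add: leval_ext)

lemma leval_cong:
  "(\<And>m i. m \<in> keys f \<Longrightarrow> i \<in> keys m \<Longrightarrow> v i = w i) \<Longrightarrow> leval v f = leval w f"
  unfolding leval_monom_eval by (intro sum.cong refl arg_cong2[of _ _ _ _ times] monom_eval_cong) auto

lemma leval_zero [simp]: "leval v 0 = 0"
  by (simp add: leval_def)

lemma leval_mult:
  assumes "f \<in> carrier (laurent_ring A)" "g \<in> carrier (laurent_ring A)" "\<And>i. i \<in> A \<Longrightarrow> v i \<noteq> 0"
  shows "leval v (f * g) = leval v f * leval v g"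
proof -
  have "leval v (f * g) =
      (\<Sum>a\<in>keys f. \<Sum>b\<in>keys g. lookup f a * lookup g b * monom_eval v (a + b))"
    by (subst times_poly_mapping_sum) (simp add: leval_sum leval_single)
  also have "\<dots> = (\<Sum>a\<in>keys f. \<Sum>b\<in>keys g.
      (lookup f a * monom_eval v a) * (lookup g b * monom_eval v b))"
  proof (intro sum.cong refl)
    fix a b assume "a \<in> keys f" "b \<in> keys g"
    then have "monom_eval v (a + b) = monom_eval v a * monom_eval v b"
      using assms(1,2) by (intro monom_eval_add assms(3)) (auto simp: carrier_laurent_ring)
    then show "lookup f a * lookup g b * monom_eval v (a + b) =
        (lookup f a * monom_eval v a) * (lookup g b * monom_eval v b)"
      by simp
  qed
  finally show ?thesis
    by (simp add: leval_monom_eval sum_product)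
qed

lemma torus_subset_laurent: "carrier (torus_ring A) \<subseteq> carrier (laurent_ring A)"
  by (auto simp: carrier_torus_ring carrier_laurent_ring)

text \<open>
  Laurent polynomials of degree 0 are functions on the torus of projective space: their values do
  not depend on the homogeneous coordinate vector.
\<close>

lemma leval_scale:
  assumes "f \<in> carrier (torus_ring A)" "c \<noteq> 0"
  shows "leval (\<lambda>i. c * v i) f = leval v f"
  unfolding leval_monom_eval using assms
  by (intro sum.cong refl) (auto simp: monom_eval_scale carrier_torus_ring)

lemma laurent_of_poly_superset:
  assumes "finite K" "keys g \<subseteq> K"
  shows "laurent_of_poly g = (\<Sum>m\<in>K. single (int_monom m) (lookup g m))"
  unfolding laurent_of_poly_def using assms
  by (intro sum.mono_neutral_left) (auto simp: in_keys_iff)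

lemma laurent_of_poly_add: "laurent_of_poly (f + g) = laurent_of_poly f + laurent_of_poly g"
proof -
  let ?K = "keys f \<union> keys g"
  have "laurent_of_poly (f + g) = (\<Sum>m\<in>?K. single (int_monom m) (lookup (f + g) m))"
    by (rule laurent_of_poly_superset) (auto simp: Poly_Mapping.keys_add)
  also have "\<dots> = laurent_of_poly f + laurent_of_poly g"
    by (simp add: lookup_add single_add sum.distrib laurent_of_poly_superset[of ?K])
  finally show ?thesis .
qed

lemma laurent_of_poly_zero [simp]: "laurent_of_poly 0 = 0"
  by (simp add: laurent_of_poly_def)

lemma laurent_of_poly_single [simp]:
  "laurent_of_poly (single m c) = single (int_monom m) c"
  by (cases "c = 0") (auto simp: laurent_of_poly_def)

lemma laurent_of_poly_sum: "laurent_of_poly (\<Sum>s\<in>S. f s) = (\<Sum>s\<in>S. laurent_of_poly (f s))"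
  by (induction S rule: infinite_finite_induct) (auto simp: laurent_of_poly_add)

lemma laurent_of_poly_mult: "laurent_of_poly (f * g) = laurent_of_poly f * laurent_of_poly g"
proof -
  have "laurent_of_poly (f * g) = (\<Sum>a\<in>keys f. \<Sum>b\<in>keys g.
      single (int_monom a) (lookup f a) * single (int_monom b) (lookup g b))"
    by (subst times_poly_mapping_sum) (simp add: laurent_of_poly_sum int_monom_add mult_single)
  then show ?thesis
    by (simp add: laurent_of_poly_def sum_product)
qed

lemma lookup_laurent_of_poly [simp]: "lookup (laurent_of_poly g) (int_monom m) = lookup g m"
  by (auto simp: laurent_of_poly_def lookup_sum lookup_single when_def in_keys_iff sum.delta')

lemma peval_eq_leval: "peval v f = leval v (laurent_of_poly f)"
  by (simp add: laurent_of_poly_def leval_sum leval_single peval_def monom_eval_def)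

lemma peval_zero [simp]: "peval v 0 = 0"
  by (simp add: peval_def)

lemma peval_single: "peval v (single m c) = c * monom_eval v (int_monom m)"
  by (simp add: peval_eq_leval leval_single)

lemma peval_add: "peval v (f + g) = peval v f + peval v g"
  by (simp add: peval_eq_leval laurent_of_poly_add leval_add)

lemma peval_sum: "peval v (\<Sum>s\<in>S. f s) = (\<Sum>s\<in>S. peval v (f s))"
  by (induction S rule: infinite_finite_induct) (auto simp: peval_add)

lemma monom_eval_int_monom_add:
  "monom_eval v (int_monom (a + b)) = monom_eval v (int_monom a) * monom_eval v (int_monom b)"
proof -
  let ?K = "keys a \<union> keys b"
  have "monom_eval v (int_monom (a + b)) = (\<Prod>i\<in>?K. v i powi lookup (int_monom (a + b)) i)"
    by (rule monom_eval_ext) (auto simp: Poly_Mapping.keys_add simp del: lookup_int_monom)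
  also have "\<dots> = (\<Prod>i\<in>?K. v i ^ lookup a i * v i ^ lookup b i)"
    by (simp add: lookup_add flip: power_add of_nat_add)
  also have "\<dots> = monom_eval v (int_monom a) * monom_eval v (int_monom b)"
    by (simp add: prod.distrib monom_eval_ext[of ?K])
  finally show ?thesis .
qed

lemma peval_mult: "peval v (f * g) = peval v f * peval v g"
proof -
  have "peval v (f * g) = (\<Sum>a\<in>keys f. \<Sum>b\<in>keys g.
      (lookup f a * monom_eval v (int_monom a)) * (lookup g b * monom_eval v (int_monom b)))"
    by (subst times_poly_mapping_sum)
      (simp add: peval_sum peval_single monom_eval_int_monom_add mult_ac)
  also have "\<dots> = peval v (\<Sum>a\<in>keys f. single a (lookup f a))
      * peval v (\<Sum>b\<in>keys g. single b (lookup g b))"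
    by (simp add: sum_product peval_sum peval_single)
  finally show ?thesis
    by (simp only: poly_mapping_sum_single[symmetric])
qed

lemma peval_pvar [simp]: "peval v (pvar i) = v i"
  by (simp add: pvar_def peval_single)

lemma peval_one [simp]: "peval v 1 = 1"
  by (simp add: peval_single monom_eval_def flip: single_one)

lemma peval_prod: "peval v (\<Prod>s\<in>S. f s) = (\<Prod>s\<in>S. peval v (f s))"
  by (induction S rule: infinite_finite_induct) (auto simp: peval_mult)

lemma peval_power: "peval v (f ^ k) = peval v f ^ k"
  by (induction k) (auto simp: peval_mult)

section \<open>Laurent polynomials that vanish on a torus\<close>

text \<open>
  A nonzero Laurent polynomial does not vanish identically on the torus.  This is Dedekind's
  theorem on the linear independence of characters for the characters \<open>monom_eval _ m\<close>: the
  difference of the relation translated by \<open>u\<close> and the relation multiplied by the value at \<open>u\<close> of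
  one character is a shorter relation.
\<close>

lemma independent_monom_eval:
  assumes "finite K" "\<And>m. m \<in> K \<Longrightarrow> keys m \<subseteq> A"
    and "\<And>v. (\<And>i. i \<in> A \<Longrightarrow> v i \<noteq> 0) \<Longrightarrow> (\<Sum>m\<in>K. c m * monom_eval v m) = 0"
    and "m \<in> K"
  shows "c m = 0"
  using assms
proof (induction K arbitrary: c m rule: finite_induct)
  case (insert m0 K)
  have rest: "c m = 0" if m: "m \<in> K" for m
  proof -
    from m insert.hyps have "m \<noteq> m0" by auto
    then obtain i where i: "lookup m i \<noteq> lookup m0 i"
      by (metis poly_mapping_eqI)
    \<comment> \<open>a point of the torus at which the characters of \<open>m\<close> and \<open>m0\<close> differ\<close>
    define u :: "'a \<Rightarrow> complex" where "u = (\<lambda>j. if j = i then 2 else 1)"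
    have u: "monom_eval u a = 2 powi lookup a i" for a
    proof -
      have "monom_eval u a = (\<Prod>j\<in>insert i (keys a). u j powi lookup a j)"
        by (rule monom_eval_ext) auto
      also have "\<dots> = (\<Prod>j\<in>insert i (keys a). if j = i then 2 powi lookup a j else 1)"
        by (intro prod.cong refl) (simp add: u_def)
      also have "\<dots> = 2 powi lookup a i"
        by (subst prod.delta) auto
      finally show ?thesis .
    qed
    have "c m * (monom_eval u m - monom_eval u m0) = 0"
    proof (rule insert.IH[of "\<lambda>a. c a * (monom_eval u a - monom_eval u m0)"])
      fix v :: "'a \<Rightarrow> complex" assume v: "\<And>i. i \<in> A \<Longrightarrow> v i \<noteq> 0"
      have uv: "monom_eval (\<lambda>j. u j * v j) a = monom_eval u a * monom_eval v a" for a
        by (simp add: monom_eval_def power_int_mult_distrib prod.distrib)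
      have "(\<Sum>a\<in>insert m0 K. c a * monom_eval (\<lambda>j. u j * v j) a) = 0"
        by (rule insert.prems(2)) (simp add: u_def v)
      moreover have "(\<Sum>a\<in>insert m0 K. c a * monom_eval v a) = 0"
        by (rule insert.prems(2)) (simp add: v)
      moreover have "(\<Sum>a\<in>insert m0 K. c a * (monom_eval u a - monom_eval u m0) * monom_eval v a) =
          (\<Sum>a\<in>insert m0 K. c a * monom_eval (\<lambda>j. u j * v j) a)
          - monom_eval u m0 * (\<Sum>a\<in>insert m0 K. c a * monom_eval v a)"
        unfolding uv sum_distrib_left sum_subtractf[symmetric]
        by (intro sum.cong refl) (simp add: algebra_simps)
      ultimately have
        "(\<Sum>a\<in>insert m0 K. c a * (monom_eval u a - monom_eval u m0) * monom_eval v a) = 0"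
        by (simp only: mult_zero_right diff_self)
      then show "(\<Sum>a\<in>K. c a * (monom_eval u a - monom_eval u m0) * monom_eval v a) = 0"
        using insert.hyps by simp
    qed (use insert.prems(1) m in auto)
    moreover have "monom_eval u m \<noteq> monom_eval u m0"
    proof
      assume "monom_eval u m = monom_eval u m0"
      then have "norm ((2::complex) powi lookup m i) = norm ((2::complex) powi lookup m0 i)"
        by (simp add: u)
      then have "(2::real) powi lookup m i = 2 powi lookup m0 i"
        by (simp add: norm_power_int)
      with i show False
        using power_int_strict_increasing[of "lookup m i" "lookup m0 i" "2::real"]
          power_int_strict_increasing[of "lookup m0 i" "lookup m i" "2::real"]
        by linarith
    qed
    ultimately show ?thesis by simp
  qed
  have "(\<Sum>a\<in>insert m0 K. c a * monom_eval (\<lambda>_. 1) a) = 0"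
    by (rule insert.prems(2)) auto
  then have "c m0 = 0"
    using insert.hyps rest by (simp add: monom_eval_def)
  with rest insert.prems(3) show ?case by auto
qed auto

lemma laurent_eq_zeroI:
  assumes "f \<in> carrier (laurent_ring A)"
    and "\<And>v. (\<And>i. i \<in> A \<Longrightarrow> v i \<noteq> 0) \<Longrightarrow> leval v f = 0"
  shows "f = 0"
proof (rule ccontr)
  assume "f \<noteq> 0"
  then obtain m where "m \<in> keys f"
    by (metis all_not_in_conv keys_eq_empty)
  moreover have "lookup f m = 0"
  proof (rule independent_monom_eval[where K = "keys f" and A = A])
    show "(\<Sum>m\<in>keys f. lookup f m * monom_eval v m) = 0" if "\<And>i. i \<in> A \<Longrightarrow> v i \<noteq> 0" for v
      using assms(2)[OF that] by (simp only: leval_monom_eval)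
  qed (use assms(1) \<open>m \<in> keys f\<close> in \<open>auto simp: carrier_laurent_ring\<close>)
  ultimately show False
    by (simp add: in_keys_iff)
qed

section \<open>Ideals of projective varieties and of their tori\<close>

lemma monoid_ring_ops [simp]:
  "add (monoid_ring M) = (+)" "mult (monoid_ring M) = (*)"
  "zero (monoid_ring M) = 0" "one (monoid_ring M) = 1"
  by (simp_all add: monoid_ring_def)

lemma poly_ring_ops [simp]:
  "add (poly_ring A) = (+)" "mult (poly_ring A) = (*)"
  "zero (poly_ring A) = 0" "one (poly_ring A) = 1"
  by (simp_all add: poly_ring_def)

lemma torus_ring_ops [simp]:
  "add (torus_ring A) = (+)" "mult (torus_ring A) = (*)"
  "zero (torus_ring A) = 0" "one (torus_ring A) = 1"
  by (simp_all add: torus_ring_def)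

lemma ideal_monoid_ring:
  assumes R: "R = monoid_ring M" and "cring R" and sub: "I \<subseteq> carrier R" and zero: "0 \<in> I"
    and add: "\<And>f g. f \<in> I \<Longrightarrow> g \<in> I \<Longrightarrow> f + g \<in> I"
    and mult: "\<And>f g. f \<in> I \<Longrightarrow> g \<in> carrier R \<Longrightarrow> f * g \<in> I"
  shows "ideal I R"
proof -
  interpret R: cring "monoid_ring M" using assms(2) unfolding R .
  have minus_one: "- 1 \<in> carrier (monoid_ring M)"
    using R.one_closed by (auto simp: monoid_ring_def in_keys_iff)
  have inv: "inv\<^bsub>add_monoid (monoid_ring M)\<^esub> f \<in> I" if "f \<in> I" for f
  proof -
    have "- f \<in> I"
      using mult[OF that, of "- 1"] minus_one by (simp add: R)
    moreover have "\<ominus>\<^bsub>monoid_ring M\<^esub> f = - f"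
      by (rule R.minus_equality) (use that \<open>- f \<in> I\<close> sub in \<open>auto simp: R\<close>)
    ultimately show ?thesis by (simp add: a_inv_def)
  qed
  show ?thesis
    unfolding R
  proof (rule idealI)
    show "subgroup I (add_monoid (monoid_ring M))"
      by (rule subgroup.intro) (use sub zero add inv in \<open>auto simp: R\<close>)
  qed (use mult in \<open>auto simp: R R.ring_axioms mult.commute\<close>)
qed

lemma ideal_vanishing_ideal: "ideal (vanishing_ideal A X) (poly_ring A)"
proof -
  interpret R: cring "poly_ring A" by (rule cring_poly_ring)
  show ?thesis
    by (rule ideal_monoid_ring[OF poly_ring_def])
      (use R.add.m_closed R.m_closed R.zero_closed in
        \<open>auto simp: vanishing_ideal_def peval_add peval_mult cring_poly_ring\<close>)
qed

lemma ideal_torus_ideal: "ideal (torus_ideal A X) (torus_ring A)"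
proof -
  interpret R: cring "torus_ring A" by (rule cring_torus_ring)
  have mult: "leval v (f * g) = leval v f * leval v g"
    if "f \<in> carrier (torus_ring A)" "g \<in> carrier (torus_ring A)" "\<forall>i\<in>A. v i \<noteq> 0" for f g v
    using that torus_subset_laurent by (intro leval_mult[of f A g v]) auto
  show ?thesis
    by (rule ideal_monoid_ring[OF torus_ring_def])
      (use R.add.m_closed R.m_closed R.zero_closed in
        \<open>auto simp: torus_ideal_def leval_add mult cring_torus_ring\<close>)
qed

text \<open>The homogeneous component of degree \<open>k\<close> of a polynomial.\<close>

definition hcomp :: "nat \<Rightarrow> 'v mpoly \<Rightarrow> 'v mpoly" where
  "hcomp k f = (\<Sum>m\<in>{m\<in>keys f. mdeg m = k}. single m (lookup f m))"

lemma lookup_hcomp: "lookup (hcomp k f) m = (if k = mdeg m then lookup f m else 0)"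
  by (auto simp: hcomp_def lookup_sum lookup_single when_def in_keys_iff sum.delta')

lemma keys_hcomp: "keys (hcomp k f) = {m\<in>keys f. mdeg m = k}"
  by (auto simp: in_keys_iff lookup_hcomp split: if_splits)

lemma sum_hcomp: "\<exists>N\<ge>k. (\<Sum>j\<le>N. hcomp j f) = f"
proof -
  define N where "N = Max (insert k (mdeg ` keys f))"
  have N: "mdeg m \<le> N" if "m \<in> keys f" for m
    using that by (auto simp: N_def)
  have "(\<Sum>j\<le>N. hcomp j f) = f"
    by (rule poly_mapping_eqI) (use N in \<open>force simp: lookup_sum lookup_hcomp in_keys_iff\<close>)
  moreover have "k \<le> N" by (simp add: N_def)
  ultimately show ?thesis by blast
qed

lemma peval_scale:
  assumes "\<And>m. m \<in> keys f \<Longrightarrow> mdeg m = k" "c \<noteq> 0"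
  shows "peval (\<lambda>i. c * v i) f = c ^ k * peval v f"
proof -
  have "peval w f = (\<Sum>m\<in>keys f. lookup f m * monom_eval w (int_monom m))" for w
    by (simp add: peval_eq_leval laurent_of_poly_def leval_sum leval_single)
  with assms show ?thesis
    by (simp add: monom_eval_scale sum_distrib_left mult_ac)
qed

text \<open>
  If \<open>f\<close> vanishes on the line through \<open>v\<close>, so do its homogeneous components: their values at \<open>v\<close>
  are the coefficients of a polynomial in the scaling factor \<open>c\<close> with infinitely many zeros.
\<close>

lemma peval_hcomp_eq_zero:
  assumes "\<And>c. c \<noteq> 0 \<Longrightarrow> peval (\<lambda>i. c * v i) f = 0"
  shows "peval v (hcomp k f) = 0"
proof (rule ccontr)
  assume k: "peval v (hcomp k f) \<noteq> 0"
  obtain N where N: "N \<ge> k" "(\<Sum>j\<le>N. hcomp j f) = f"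
    using sum_hcomp by blast
  have "(\<Sum>j\<le>N. peval v (hcomp j f) * c ^ j) = 0" if "c \<noteq> 0" for c
  proof -
    have "peval (\<lambda>i. c * v i) (\<Sum>j\<le>N. hcomp j f) = 0"
      using assms[OF that] N(2) by simp
    moreover have "peval (\<lambda>i. c * v i) (hcomp j f) = c ^ j * peval v (hcomp j f)" for j
      by (rule peval_scale) (auto simp: keys_hcomp that)
    ultimately show ?thesis
      by (simp add: peval_sum mult.commute)
  qed
  then have "UNIV - {0} \<subseteq> {c. (\<Sum>j\<le>N. peval v (hcomp j f) * c ^ j) = 0}"
    by auto
  moreover have "finite {c. (\<Sum>j\<le>N. peval v (hcomp j f) * c ^ j) = 0}"
    using k N(1) polyfun_finite_roots[of "\<lambda>j. peval v (hcomp j f)" N] by auto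
  ultimately have "finite (UNIV - {0::complex})"
    by (rule finite_subset)
  then show False
    by (simp add: infinite_UNIV_char_0)
qed

lemma proj_space_scale:
  assumes "P \<in> proj_space A" "v \<in> P" "c \<noteq> 0"
  shows "(\<lambda>i. c * v i) \<in> P"
proof -
  from assms(1,2) obtain w b where P: "P = proj_point w" and b: "b \<noteq> 0" "v = (\<lambda>i. b * w i)"
    by (auto simp: proj_space_def proj_point_def)
  have "(\<lambda>i. c * v i) = (\<lambda>i. (c * b) * w i)"
    by (simp add: b mult.assoc)
  with P b assms(3) show ?thesis
    by (auto simp: proj_point_def)
qed

lemma subset_proj_closure: "X \<subseteq> proj_closure A X"
  by (auto simp: proj_closure_def)

lemma peval_proj_closure:
  assumes "f \<in> carrier (poly_ring A)" "homogeneous f" "X \<subseteq> proj_space A"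
    and "\<And>P v. P \<in> X \<Longrightarrow> v \<in> P \<Longrightarrow> peval v f = 0"
    and "P \<in> proj_closure A X" "v \<in> P"
  shows "peval v f = 0"
proof -
  let ?Z = "{P \<in> proj_space A. \<forall>v\<in>P. \<forall>g\<in>{f}. peval v g = 0}"
  have "proj_closed A ?Z"
    unfolding proj_closed_def using assms(1,2) by (intro exI[of _ "{f}"]) auto
  moreover have "X \<subseteq> ?Z"
    using assms(3,4) by auto
  ultimately have "P \<in> ?Z"
    using assms(5) unfolding proj_closure_def by blast
  with assms(6) show ?thesis by auto
qed

lemma hcomp_vanishing_ideal:
  assumes f: "f \<in> vanishing_ideal A X" and X: "X \<subseteq> proj_space A"
  shows "hcomp k f \<in> vanishing_ideal A X"
proof -
  have "peval v (hcomp k f) = 0" if "P \<in> X" "v \<in> P" for P v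
  proof (rule peval_hcomp_eq_zero)
    fix c :: complex assume "c \<noteq> 0"
    with that X have "(\<lambda>i. c * v i) \<in> P"
      by (intro proj_space_scale) auto
    with f that(1) show "peval (\<lambda>i. c * v i) f = 0"
      by (auto simp: vanishing_ideal_def)
  qed
  with f show ?thesis
    by (auto simp: vanishing_ideal_def carrier_poly_ring keys_hcomp)
qed

lemma vanishing_ideal_proj_closure:
  assumes X: "X \<subseteq> proj_space A"
  shows "vanishing_ideal A (proj_closure A X) = vanishing_ideal A X"
proof (intro equalityI subsetI)
  fix f assume f: "f \<in> vanishing_ideal A X"
  have "peval v f = 0" if "P \<in> proj_closure A X" "v \<in> P" for P v
  proof -
    have comp: "peval v (hcomp k f) = 0" for k
    proof (rule peval_proj_closure[OF _ _ X _ that])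
      show "homogeneous (hcomp k f)"
        by (auto simp: homogeneous_iff keys_hcomp)
    qed (use hcomp_vanishing_ideal[OF f X, of k] in \<open>auto simp: vanishing_ideal_def\<close>)
    obtain N where "(\<Sum>j\<le>N. hcomp j f) = f"
      using sum_hcomp by blast
    then have "peval v f = (\<Sum>j\<le>N. peval v (hcomp j f))"
      by (metis peval_sum)
    with comp show ?thesis by simp
  qed
  with f show "f \<in> vanishing_ideal A (proj_closure A X)"
    by (auto simp: vanishing_ideal_def)
next
  fix f assume "f \<in> vanishing_ideal A (proj_closure A X)"
  then show "f \<in> vanishing_ideal A X"
    using subset_proj_closure[of X A] by (auto simp: vanishing_ideal_def)
qed

section \<open>Numerators and saturation\<close>

lemma keys_laurent_of_poly: "keys (laurent_of_poly g) = int_monom ` keys g"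
proof
  show "keys (laurent_of_poly g) \<subseteq> int_monom ` keys g"
    unfolding laurent_of_poly_def
    by (rule order_trans[OF Poly_Mapping.keys_sum]) (auto split: if_splits)
qed (auto simp: in_keys_iff)

lemma minus_single_add:
  assumes "lookup m i > (0::nat)"
  shows "single i 1 + (m - single i 1) = m"
  by (rule poly_mapping_eqI)
    (use assms in \<open>auto simp: lookup_add lookup_minus lookup_single when_def\<close>)

lemma pvar_dvdI:
  assumes "\<And>m. m \<in> keys g \<Longrightarrow> lookup m i > 0"
  shows "pvar i dvd g"
proof
  have "pvar i * (\<Sum>m\<in>keys g. single (m - single i 1) (lookup g m)) =
      (\<Sum>m\<in>keys g. single (single i 1 + (m - single i 1)) (lookup g m))"
    by (simp add: pvar_def sum_distrib_left mult_single)
  also have "\<dots> = (\<Sum>m\<in>keys g. single m (lookup g m))"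
    using assms by (intro sum.cong refl arg_cong2[of _ _ _ _ single] minus_single_add) auto
  finally show "g = pvar i * (\<Sum>m\<in>keys g. single (m - single i 1) (lookup g m))"
    by (simp only: poly_mapping_sum_single[symmetric])
qed

text \<open>
  A variable outside \<open>A\<close> that occurs in the denominator of a Laurent polynomial over \<open>A\<close> divides the
  numerator, which contradicts lowest terms.
\<close>

lemma exponent_outside:
  assumes f: "f \<in> carrier (laurent_ring A)"
    and d: "laurent_of_poly g = single (int_monom d) 1 * f"
    and m: "m \<in> keys g" and i: "i \<notin> A"
  shows "lookup m i = lookup d i"
proof -
  have "int_monom m \<in> keys (single (int_monom d) 1 * f)"
    using m by (simp flip: d add: keys_laurent_of_poly)
  then obtain a where a: "a \<in> keys f" "int_monom m = int_monom d + a"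
    using keys_mult[of "single (int_monom d) 1" f] by auto
  have "i \<notin> keys a"
    using f a(1) i by (auto simp: carrier_laurent_ring)
  then have "lookup (int_monom m) i = lookup (int_monom d) i"
    by (simp only: a(2) lookup_add in_keys_iff) simp
  then show ?thesis by simp
qed

lemma numerator_denominator:
  assumes f: "f \<in> carrier (laurent_ring A)" and g: "is_numerator f g"
  obtains d where "laurent_of_poly g = single (int_monom d) 1 * f" "keys d \<subseteq> A"
proof -
  from g obtain d where d: "laurent_of_poly g = single (int_monom d) 1 * f"
    and low: "\<forall>i\<in>keys d. \<not> pvar i dvd g"
    by (auto simp: is_numerator_def)
  have "i \<in> A" if i: "i \<in> keys d" for i
  proof (rule ccontr)
    assume "i \<notin> A"
    then have "pvar i dvd g"
      using exponent_outside[OF f d] i by (intro pvar_dvdI) (simp add: in_keys_iff)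
    with low i show False by blast
  qed
  with d that show ?thesis by blast
qed

lemma numerator_in_poly_ring:
  assumes f: "f \<in> carrier (laurent_ring A)" and g: "is_numerator f g"
  shows "g \<in> carrier (poly_ring A)"
proof -
  obtain d where d: "laurent_of_poly g = single (int_monom d) 1 * f" "keys d \<subseteq> A"
    using numerator_denominator[OF f g] by blast
  have "i \<in> A" if "m \<in> keys g" "i \<in> keys m" for m i
  proof (rule ccontr)
    assume i: "i \<notin> A"
    with exponent_outside[OF f d(1) that(1)] that(2) have "i \<in> keys d"
      by (simp add: in_keys_iff)
    with d(2) i show False by blast
  qed
  then show ?thesis by (auto simp: carrier_poly_ring)
qed

lemma single_times_cancel:
  fixes f g :: "'v lpoly"
  assumes "single m 1 * f = single m 1 * g"
  shows "f = g"
proof -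
  have "single (- m) 1 * (single m 1 * f) = single (- m) 1 * (single m 1 * g)"
    using assms by simp
  then show ?thesis
    by (simp add: mult_single flip: mult.assoc)
qed

text \<open>
  Every representation of a Laurent polynomial as a polynomial divided by a monomial arises from the
  one in lowest terms by extending the fraction by a monomial.
\<close>

lemma numerator_exists:
  assumes "laurent_of_poly h = single (int_monom d) 1 * f"
  shows "\<exists>g e. is_numerator f g \<and> keys e \<subseteq> keys d \<and> h = single e 1 * g"
  using assms
proof (induction "mdeg d" arbitrary: d h rule: less_induct)
  case less
  show ?case
  proof (cases "\<exists>i\<in>keys d. pvar i dvd h")
    case False
    with less.prems have "is_numerator f h"
      by (auto simp: is_numerator_def)
    then show ?thesis
      by (intro exI[of _ h] exI[of _ 0]) simp
  next
    case True
    then obtain i h' where i: "i \<in> keys d" and h: "h = pvar i * h'"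
      by (auto elim: dvdE)
    define d' where "d' = d - single i 1"
    have d: "d = single i 1 + d'"
      unfolding d'_def using i by (intro minus_single_add[symmetric]) (simp add: in_keys_iff)
    have keys: "keys d' \<subseteq> keys d"
      by (auto simp: d lookup_add in_keys_iff)
    have "single (single i 1) 1 * laurent_of_poly h' =
        single (single i 1) 1 * (single (int_monom d') 1 * f)"
      using less.prems
      by (simp add: h d pvar_def laurent_of_poly_mult int_monom_add mult_single
          flip: mult.assoc)
    then have "laurent_of_poly h' = single (int_monom d') 1 * f"
      by (rule single_times_cancel)
    moreover have "mdeg d' < mdeg d"
      by (simp add: d mdeg_add)
    ultimately obtain g e where "is_numerator f g" "keys e \<subseteq> keys d'" "h' = single e 1 * g"
      using less.hyps by blast
    moreover have "keys (single i 1 + e) \<subseteq> insert i (keys e)"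
      using Poly_Mapping.keys_add[of "single i 1" e] by auto
    ultimately show ?thesis
      using keys i h
      by (intro exI[of _ g] exI[of _ "single i 1 + e"])
        (auto simp: pvar_def mult_single simp flip: mult.assoc)
  qed
qed

lemma peval_numerator_eq_zero:
  assumes "is_numerator f g" "leval v f = 0" "f \<in> carrier (laurent_ring A)"
    and v: "\<And>i. i \<in> A \<Longrightarrow> v i \<noteq> 0"
  shows "peval v g = 0"
proof -
  obtain d where d: "laurent_of_poly g = single (int_monom d) 1 * f" "keys d \<subseteq> A"
    using numerator_denominator[OF assms(3,1)] by blast
  then have "single (int_monom d) 1 \<in> carrier (laurent_ring A)"
    by (simp add: carrier_laurent_ring)
  from leval_mult[OF this assms(3) v] show ?thesis
    by (simp add: peval_eq_leval d assms(2))
qed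

text \<open>
  For a set \<open>X\<close> of torus points, the ideal of the projective closure is determined by the ideal of
  \<open>X\<close> in the functions on the torus: a form \<open>h\<close> of
  degree \<open>k\<close> that vanishes on \<open>X\<close> is a monomial multiple of the numerator of \<open>h / z\<^sub>a\<^sup>k\<close>, which is a
  function on the torus; conversely, the product of the variables has no zeros on \<open>X\<close>.
\<close>

lemma vanishing_ideal_proj_closure_eq_saturation:
  assumes "finite A" "a \<in> A" and X: "X \<subseteq> proj_space A"
    and torus: "\<And>P v i. P \<in> X \<Longrightarrow> v \<in> P \<Longrightarrow> i \<in> A \<Longrightarrow> v i \<noteq> 0"
  shows "vanishing_ideal A (proj_closure A X) =
    saturation (poly_ring A) (num_ideal A (torus_ideal A X)) (\<Prod>i\<in>A. pvar i)"
proof -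
  interpret R: cring "poly_ring A" by (rule cring_poly_ring)
  have pow: "f [^]\<^bsub>poly_ring A\<^esub> N = f ^ N" for f and N :: nat
    by (induction N) (simp_all add: mult.commute)
  let ?G = "{g. \<exists>f\<in>torus_ideal A X. is_numerator f g}"
  have torus_laurent: "torus_ideal A X \<subseteq> carrier (laurent_ring A)"
    using torus_subset_laurent by (auto simp: torus_ideal_def)
  \<comment> \<open>without this inclusion, no ideal contains \<open>?G\<close>, and \<open>Idl\<close> of it would be the whole type\<close>
  then have G: "?G \<subseteq> carrier (poly_ring A)"
    using numerator_in_poly_ring by blast
  have ideal: "ideal (num_ideal A (torus_ideal A X)) (poly_ring A)"
    unfolding num_ideal_def by (rule R.genideal_ideal[OF G])
  interpret J: ideal "num_ideal A (torus_ideal A X)" "poly_ring A" by (rule ideal)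
  have num: "h \<in> num_ideal A (torus_ideal A X)"
    if h: "h \<in> vanishing_ideal A X" and k: "\<And>m. m \<in> keys h \<Longrightarrow> mdeg m = k" for h k
  proof -
    define f where "f = single (single a (- int k)) 1 * laurent_of_poly h"
    have hf: "laurent_of_poly h = single (int_monom (single a k)) 1 * f"
      by (simp add: f_def mult_single flip: mult.assoc single_add)
    have h_laurent: "laurent_of_poly h \<in> carrier (laurent_ring A)"
      using h by (auto simp: vanishing_ideal_def carrier_laurent_ring carrier_poly_ring
          keys_laurent_of_poly)
    have "f \<in> carrier (torus_ring A)"
    proof -
      have "keys m \<subseteq> A \<and> mdeg m = 0" if "m \<in> keys f" for m
      proof -
        from that obtain b where b: "b \<in> keys h" "m = single a (- int k) + int_monom b"
          using keys_mult[of "single (single a (- int k)) 1" "laurent_of_poly h"]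
          by (auto simp: f_def keys_laurent_of_poly)
        have "keys m \<subseteq> keys (single a (- int k)) \<union> keys (int_monom b)"
          unfolding b(2) by (rule Poly_Mapping.keys_add)
        moreover have "keys b \<subseteq> A"
          using h b(1) by (auto simp: vanishing_ideal_def carrier_poly_ring)
        ultimately show ?thesis
          using \<open>a \<in> A\<close> k[OF b(1)] by (auto simp: b(2) mdeg_add split: if_splits)
      qed
      then show ?thesis by (auto simp: carrier_torus_ring)
    qed
    moreover have "leval v f = 0" if "P \<in> X" "v \<in> P" for P v
    proof -
      have "leval v f = leval v (single (single a (- int k)) 1) * leval v (laurent_of_poly h)"
        unfolding f_def
      proof (rule leval_mult[OF _ h_laurent])
        show "single (single a (- int k)) 1 \<in> carrier (laurent_ring A)"
          using \<open>a \<in> A\<close> by (auto simp: carrier_laurent_ring)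
      qed (use torus that in auto)
      also have "leval v (laurent_of_poly h) = 0"
        using h that by (auto simp: vanishing_ideal_def peval_eq_leval)
      finally show ?thesis by simp
    qed
    ultimately have "f \<in> torus_ideal A X"
      by (auto simp: torus_ideal_def)
    moreover obtain g e where g: "is_numerator f g" and e: "keys e \<subseteq> keys (single a k)"
      and h_eq: "h = single e 1 * g"
      using numerator_exists[OF hf] by blast
    ultimately have "g \<in> num_ideal A (torus_ideal A X)"
      unfolding num_ideal_def using R.genideal_self[OF G] by blast
    moreover have "single e 1 \<in> carrier (poly_ring A)"
      using e \<open>a \<in> A\<close> by (auto simp: carrier_poly_ring split: if_splits)
    ultimately show ?thesis
      using J.I_l_closed[of g "single e 1"] by (simp add: h_eq)
  qed
  have "f \<in> num_ideal A (torus_ideal A X)" if f: "f \<in> vanishing_ideal A X" for f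
  proof -
    obtain N where N: "(\<Sum>j\<le>N. hcomp j f) = f"
      using sum_hcomp by blast
    have comp: "hcomp j f \<in> num_ideal A (torus_ideal A X)" for j
      by (rule num[OF hcomp_vanishing_ideal[OF f X]]) (auto simp: keys_hcomp)
    have "(\<Sum>j\<le>N. hcomp j f) \<in> num_ideal A (torus_ideal A X)" for N
    proof (induction N)
      case (Suc N)
      then show ?case using J.a_closed[OF Suc comp] by simp
    qed (simp add: comp)
    with N show ?thesis by metis
  qed
  \<comment> \<open>so the saturation exponent 0 suffices\<close>
  then have "vanishing_ideal A X \<subseteq>
      saturation (poly_ring A) (num_ideal A (torus_ideal A X)) (\<Prod>i\<in>A. pvar i)"
    by (auto simp: saturation_def vanishing_ideal_def pow intro!: exI[of _ 0])
  moreover have "saturation (poly_ring A) (num_ideal A (torus_ideal A X)) (\<Prod>i\<in>A. pvar i)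
      \<subseteq> vanishing_ideal A X"
  proof
    fix f assume f: "f \<in> saturation (poly_ring A) (num_ideal A (torus_ideal A X)) (\<Prod>i\<in>A. pvar i)"
    have "?G \<subseteq> vanishing_ideal A X"
    proof
      fix g assume g: "g \<in> ?G"
      then obtain q where q: "q \<in> torus_ideal A X" "is_numerator q g"
        by blast
      have "peval v g = 0" if "P \<in> X" "v \<in> P" for P v
        by (rule peval_numerator_eq_zero[OF q(2), where A = A])
          (use q(1) torus_laurent torus that in \<open>auto simp: torus_ideal_def\<close>)
      with g G show "g \<in> vanishing_ideal A X"
        by (auto simp: vanishing_ideal_def)
    qed
    then have "num_ideal A (torus_ideal A X) \<subseteq> vanishing_ideal A X"
      unfolding num_ideal_def by (rule R.genideal_minimal[OF ideal_vanishing_ideal])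
    with f obtain N where N: "f * (\<Prod>i\<in>A. pvar i) ^ N \<in> vanishing_ideal A X"
      by (auto simp: saturation_def pow)
    have "peval v f = 0" if "P \<in> X" "v \<in> P" for P v
    proof -
      have "peval v f * (\<Prod>i\<in>A. v i) ^ N = 0"
        using N that by (auto simp: vanishing_ideal_def peval_mult peval_power peval_prod)
      moreover have "(\<Prod>i\<in>A. v i) \<noteq> 0"
        using torus[OF that] \<open>finite A\<close> by simp
      ultimately show ?thesis by simp
    qed
    with f show "f \<in> vanishing_ideal A X"
      by (auto simp: vanishing_ideal_def saturation_def)
  qed
  ultimately show ?thesis
    by (simp add: vanishing_ideal_proj_closure[OF X])
qed

section \<open>Rescaling Pluecker coordinates\<close>

lemma transpose_in_Sigma_perms:
  assumes "3 \<le> a" "a \<le> n" "3 \<le> b" "b \<le> n"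
  shows "Transposition.transpose a b \<in> Sigma_perms n"
  using assms by (auto simp: Sigma_perms_def transpose_def intro: permutes_swap_id)

lemma skew_nonzero_adjacent:
  assumes "n \<ge> 3" "\<forall>e\<in>pairs n. p e \<noteq> 0" "\<sigma> \<in> Sigma_perms n" "i \<in> {1..n}"
  shows "skew p (\<sigma> i) (\<sigma> (cyc_next n i)) \<noteq> 0"
proof -
  have perm: "\<sigma> permutes {1..n}"
    using assms(3) by (simp add: Sigma_perms_def)
  have next_i: "cyc_next n i \<in> {1..n}" "cyc_next n i \<noteq> i"
    using assms(1,4) by (auto simp: cyc_next_def)
  have "\<sigma> i \<in> {1..n}" "\<sigma> (cyc_next n i) \<in> {1..n}"
    using permutes_in_image[OF perm] next_i assms(4) by auto
  moreover have "\<sigma> i \<noteq> \<sigma> (cyc_next n i)"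
    using permutes_inj[OF perm] next_i by (metis injD)
  ultimately show ?thesis
    using assms(2) by (auto simp: skew_def pairs_def)
qed

text \<open>
  The domain of definition of the Parke--Taylor map is the torus: any two points of \<open>{1..n}\<close> are
  cyclically adjacent for the identity or for a transposition in \<open>Sigma_perms n\<close>.
\<close>

lemma phi_defined_iff:
  assumes n: "n \<ge> 3"
  shows "phi_defined n p \<longleftrightarrow> (\<forall>e\<in>pairs n. p e \<noteq> 0)"
proof (intro iffI ballI)
  fix e assume p: "phi_defined n p" and "e \<in> pairs n"
  then obtain i j where e: "e = (i, j)" "1 \<le> i" "i < j" "j \<le> n"
    by (auto simp: pairs_def)
  have adj: "skew p (Transposition.transpose a b k) (Transposition.transpose a b (cyc_next n k)) \<noteq> 0"
    if "3 \<le> a" "a \<le> n" "3 \<le> b" "b \<le> n" "k \<in> {1..n}" for a b k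
    using p transpose_in_Sigma_perms[OF that(1-4)] that(5) by (auto simp: phi_defined_def)
  consider "i \<ge> 2" | "i = 1" "j = 2" | "i = 1" "j \<ge> 3"
    using e by linarith
  \<comment> \<open>\<open>i\<close> and \<open>j\<close> are moved to the positions \<open>i, i + 1\<close> or \<open>n, 1\<close>, or are in place already\<close>
  then show "p e \<noteq> 0"
  proof cases
    case 1
    with adj[of "i + 1" j i] e show ?thesis
      by (simp add: skew_def cyc_next_def transpose_def)
  next
    case 2
    with adj[of n n 1] e n show ?thesis
      by (simp add: skew_def cyc_next_def transpose_def numeral_2_eq_2)
  next
    case 3
    with adj[of n j n] e n show ?thesis
      by (auto simp: skew_def cyc_next_def transpose_def)
  qed
next
  assume "\<forall>e\<in>pairs n. p e \<noteq> 0"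
  with n show "phi_defined n p"
    using skew_nonzero_adjacent unfolding phi_defined_def by blast
qed

lemma phi_nonzero: "phi_defined n p \<Longrightarrow> \<sigma> \<in> Sigma_perms n \<Longrightarrow> phi n p \<sigma> \<noteq> 0"
  by (simp add: phi_defined_def phi_def)

lemma bij_betw_cyc_next: "n \<ge> 1 \<Longrightarrow> bij_betw (cyc_next n) {1..n} {1..n}"
  by (rule bij_betw_byWitness[where f' = "\<lambda>i. if i = 1 then n else i - 1"])
    (auto simp: cyc_next_def)

text \<open>
  Every index occurs in exactly two factors of a Parke--Taylor product, so rescaling \<open>p\<^sub>i\<^sub>j\<close> by
  \<open>c t\<^sub>i t\<^sub>j\<close> does not change the image point in projective space.
\<close>

lemma phi_rescale:
  assumes n: "n \<ge> 1" and q: "\<And>i j. (i, j) \<in> pairs n \<Longrightarrow> q (i, j) = c * t i * t j * p (i, j)"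
  shows "phi n q = (\<lambda>\<sigma>. (1 / c) ^ n * (\<Prod>i\<in>{1..n}. 1 / t i)\<^sup>2 * phi n p \<sigma>)"
proof
  fix \<sigma>
  show "phi n q \<sigma> = (1 / c) ^ n * (\<Prod>i\<in>{1..n}. 1 / t i)\<^sup>2 * phi n p \<sigma>"
  proof (cases "\<sigma> \<in> Sigma_perms n")
    case True
    then have perm: "\<sigma> permutes {1..n}"
      by (simp add: Sigma_perms_def)
    have bij: "bij_betw (cyc_next n) {1..n} {1..n}"
      using n by (rule bij_betw_cyc_next)
    have skew: "skew q i j = c * t i * t j * skew p i j" if "i \<in> {1..n}" "j \<in> {1..n}" for i j
      using that q[of i j] q[of j i] by (auto simp: skew_def pairs_def)
    have "phi n q \<sigma> = (\<Prod>i\<in>{1..n}. 1 / skew q (\<sigma> i) (\<sigma> (cyc_next n i)))"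
      using True by (simp add: phi_def)
    also have "\<dots> = (\<Prod>i\<in>{1..n}. (1 / c) * (1 / t (\<sigma> i)) * (1 / t (\<sigma> (cyc_next n i))) *
        (1 / skew p (\<sigma> i) (\<sigma> (cyc_next n i))))"
    proof (intro prod.cong refl)
      fix i assume "i \<in> {1..n}"
      then have "\<sigma> i \<in> {1..n}" "\<sigma> (cyc_next n i) \<in> {1..n}"
        using permutes_in_image[OF perm] bij_betwE[OF bij] by auto
      then show "1 / skew q (\<sigma> i) (\<sigma> (cyc_next n i)) = (1 / c) * (1 / t (\<sigma> i)) *
          (1 / t (\<sigma> (cyc_next n i))) * (1 / skew p (\<sigma> i) (\<sigma> (cyc_next n i)))"
        by (simp add: skew)
    qed
    also have "\<dots> = (1 / c) ^ n * (\<Prod>i\<in>{1..n}. 1 / t (\<sigma> i)) *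
        (\<Prod>i\<in>{1..n}. 1 / t (\<sigma> (cyc_next n i))) * phi n p \<sigma>"
      using True by (simp only: prod.distrib phi_def if_True prod_constant card_atLeastAtMost) simp
    also have "(\<Prod>i\<in>{1..n}. 1 / t (\<sigma> (cyc_next n i))) = (\<Prod>i\<in>{1..n}. 1 / t (\<sigma> i))"
      using prod.reindex_bij_betw[OF bij, of "\<lambda>i. 1 / t (\<sigma> i)"] by simp
    also have "(\<Prod>i\<in>{1..n}. 1 / t (\<sigma> i)) = (\<Prod>i\<in>{1..n}. 1 / t i)"
      using prod.permute[OF perm, of "\<lambda>i. 1 / t i"] by (simp add: o_def)
    finally show ?thesis
      by (simp add: power2_eq_square mult_ac)
  qed (simp add: phi_def)
qed

text \<open>
  Every point of the Grassmannian in the torus can be rescaled to a point of the chart \<open>W\<close>.  With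
  \<open>t\<^sub>n = 1\<close>, the conditions \<open>p\<^sub>i\<^sub>n = 1\<close> determine \<open>t\<^sub>i\<close>, and then \<open>p\<^sub>1\<^sub>2 = 1\<close> determines \<open>c\<close>.
\<close>

lemma Gr2_rescale_M0:
  assumes n: "n \<ge> 3" and P: "P \<in> Gr2 n" "p \<in> P" and p: "phi_defined n p"
  obtains q b where "q \<in> M0 n" "b \<noteq> 0" "phi n q = (\<lambda>\<sigma>. b * phi n p \<sigma>)"
proof -
  have nz: "p e \<noteq> 0" if "e \<in> pairs n" for e
    using p that phi_defined_iff[OF n] by blast
  have nz': "p (1, 2) \<noteq> 0" "\<And>i. 1 \<le> i \<Longrightarrow> i < n \<Longrightarrow> p (i, n) \<noteq> 0"
    using n by (auto intro!: nz simp: pairs_def)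
  obtain p0 x y where p0: "P = proj_point p0"
    and xy: "\<forall>(i, j)\<in>pairs n. p0 (i, j) = x i * y j - x j * y i"
    using P(1) unfolding Gr2_def by blast
  obtain a where a: "p = (\<lambda>e. a * p0 e)"
    using P(2) unfolding p0 proj_point_def by blast
  define c where "c = p (1, 2) / (p (1, n) * p (2, n))"
  define t where "t i = (if i = n then 1 else 1 / (c * p (i, n)))" for i
  define q where "q e = (if e \<in> pairs n then c * t (fst e) * t (snd e) * p e else 0)" for e
  have c: "c \<noteq> 0"
    using n nz'(1) nz'(2)[of 1] nz'(2)[of 2] by (simp add: c_def)
  have t: "t i \<noteq> 0" if "i \<in> {1..n}" for i
    using that c nz'(2)[of i] by (auto simp: t_def)
  have q12: "q (1, 2) = 1"
  proof -
    have "q (1, 2) = c * (1 / (c * p (1, n))) * (1 / (c * p (2, n))) * p (1, 2)"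
      using n by (simp add: q_def pairs_def t_def)
    also have "\<dots> = p (1, 2) / (c * (p (1, n) * p (2, n)))"
      using c by simp
    also have "c * (p (1, n) * p (2, n)) = p (1, 2)"
      using n nz'(2)[of 1] nz'(2)[of 2] by (simp add: c_def)
    finally show ?thesis
      using nz'(1) by simp
  qed
  have "q (i, n) = 1" if "i \<in> {1..n-1}" for i
    using that n c nz'(2)[of i] by (auto simp: q_def pairs_def t_def)
  with q12 have "q \<in> Wspace n"
    by (auto simp: Wspace_def vecs_def q_def)
  moreover have "proj_point q \<in> Gr2 n"
    unfolding Gr2_def
  proof (intro CollectI exI[of _ q] conjI)
    have "q \<noteq> (\<lambda>_. 0)"
      using q12 by auto
    then show "q \<in> vecs (pairs n) - {\<lambda>_. 0}"
      by (simp add: vecs_def q_def)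
    show "\<exists>x y. \<forall>(i, j)\<in>pairs n. q (i, j) = x i * y j - x j * y i"
    proof (intro exI ballI)
      fix e assume e: "e \<in> pairs n"
      obtain i j where ij: "e = (i, j)" by (cases e)
      have "q (i, j) = c * t i * t j * (a * (x i * y j - x j * y i))"
        using e xy unfolding ij by (auto simp: q_def a)
      also have "\<dots> = (c * a * t i * x i) * (t j * y j) - (c * a * t j * x j) * (t i * y i)"
        by (simp add: algebra_simps)
      finally show "case e of (i, j) \<Rightarrow>
          q (i, j) = (c * a * t i * x i) * (t j * y j) - (c * a * t j * x j) * (t i * y i)"
        by (simp add: ij)
    qed
  qed simp
  moreover have "\<forall>e\<in>pairs n. q e \<noteq> 0"
    using c t nz by (auto simp: q_def pairs_def)
  ultimately have "q \<in> M0 n"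
    by (simp add: M0_def)
  moreover have "(1 / c) ^ n * (\<Prod>i\<in>{1..n}. 1 / t i)\<^sup>2 \<noteq> 0"
    using c t by simp
  moreover have "phi n q = (\<lambda>\<sigma>. (1 / c) ^ n * (\<Prod>i\<in>{1..n}. 1 / t i)\<^sup>2 * phi n p \<sigma>)"
    by (rule phi_rescale) (use n in \<open>auto simp: q_def\<close>)
  ultimately show ?thesis
    using that by blast
qed

lemma proj_point_refl: "v \<in> proj_point v"
  by (auto simp: proj_point_def intro!: exI[of _ 1])

lemma phi_imageI:
  assumes "proj_point p \<in> X" "phi_defined n p"
  shows "proj_point (phi n p) \<in> phi_image n X"
  using assms proj_point_refl[of p] by (auto simp: phi_image_def)

lemma phi_image_torus:
  assumes "P \<in> phi_image n X" "v \<in> P" "\<sigma> \<in> Sigma_perms n"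
  shows "v \<sigma> \<noteq> 0"
  using assms by (auto simp: phi_image_def proj_point_def phi_nonzero)

lemma id_in_Sigma_perms: "id \<in> Sigma_perms n"
  by (simp add: Sigma_perms_def permutes_id)

lemma finite_Sigma_perms: "finite (Sigma_perms n)"
  by (rule finite_subset[OF _ finite_permutations[of "{1..n}"]]) (auto simp: Sigma_perms_def)

lemma phi_image_subset_proj_space: "phi_image n X \<subseteq> proj_space (Sigma_perms n)"
proof
  fix P assume "P \<in> phi_image n X"
  then obtain p where P: "P = proj_point (phi n p)" and p: "phi_defined n p"
    by (auto simp: phi_image_def)
  have "phi n p \<in> vecs (Sigma_perms n)"
    by (simp add: vecs_def phi_def)
  moreover have "phi n p \<noteq> (\<lambda>_. 0)"
    using phi_nonzero[OF p id_in_Sigma_perms] by metis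
  ultimately show "P \<in> proj_space (Sigma_perms n)"
    by (auto simp: P proj_space_def)
qed

lemma Gr2_subset_proj_space: "Gr2 n \<subseteq> proj_space (pairs n)"
  by (auto simp: Gr2_def proj_space_def)

lemma PT_open_subset_Tvar: "PT_open n \<subseteq> Tvar n"
proof -
  have "PT_open n \<subseteq> phi_image n (proj_space (pairs n))"
    using Gr2_subset_proj_space by (fastforce simp: PT_open_def phi_image_def)
  also have "\<dots> \<subseteq> Tvar n"
    unfolding Tvar_def by (rule subset_proj_closure)
  finally show ?thesis .
qed

section \<open>The ideal of the chart of the moduli space\<close>

lemma clear_denominators:
  assumes f: "f \<in> carrier (laurent_ring A)"
  obtains d g where "keys d \<subseteq> A" "g \<in> carrier (poly_ring A)"
    "laurent_of_poly g = single (int_monom d) 1 * f"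
proof
  \<comment> \<open>the product, not the least common multiple, of the denominators of the monomials\<close>
  define d where "d = (\<Sum>m\<in>keys f. nat_monom (- m))"
  define g where "g = (\<Sum>m\<in>keys f. single (nat_monom (int_monom d + m)) (lookup f m))"
  have keys_nat_monom: "keys (nat_monom m) \<subseteq> keys m" for m :: "'a \<Rightarrow>\<^sub>0 int"
    by (auto simp: in_keys_iff)
  have "keys (nat_monom (- m)) \<subseteq> A" if "m \<in> keys f" for m
    using f that keys_nat_monom[of "- m"] by (auto simp: carrier_laurent_ring)
  then show d: "keys d \<subseteq> A"
    unfolding d_def using Poly_Mapping.keys_sum[of "\<lambda>m. nat_monom (- m)" "keys f"] by blast
  have "keys (nat_monom (int_monom d + m)) \<subseteq> A" if "m \<in> keys f" for m
  proof -
    have "keys (nat_monom (int_monom d + m)) \<subseteq> keys (int_monom d) \<union> keys m"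
      by (rule order_trans[OF keys_nat_monom Poly_Mapping.keys_add])
    with d f that show ?thesis by (auto simp: carrier_laurent_ring)
  qed
  moreover have "keys g \<subseteq> (\<lambda>m. nat_monom (int_monom d + m)) ` keys f"
    unfolding g_def by (rule order_trans[OF Poly_Mapping.keys_sum]) (auto split: if_splits)
  ultimately show "g \<in> carrier (poly_ring A)"
    unfolding carrier_poly_ring by blast
  have int: "int_monom (nat_monom (int_monom d + m)) = int_monom d + m" if m: "m \<in> keys f" for m
  proof (rule int_monom_nat_monom)
    fix i
    have "nat (- lookup m i) \<le> (\<Sum>m\<in>keys f. nat (- lookup m i))"
      using m by (intro member_le_sum) auto
    also have "\<dots> = lookup d i"
      by (simp add: d_def lookup_sum)
    finally show "lookup (int_monom d + m) i \<ge> 0"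
      by (simp add: lookup_add)
  qed
  have "laurent_of_poly g = (\<Sum>m\<in>keys f. single (int_monom d) 1 * single m (lookup f m))"
    by (simp add: g_def laurent_of_poly_sum int mult_single)
  also have "\<dots> = single (int_monom d) 1 * (\<Sum>m\<in>keys f. single m (lookup f m))"
    by (simp only: sum_distrib_left)
  finally show "laurent_of_poly g = single (int_monom d) 1 * f"
    by (simp only: poly_mapping_sum_single[symmetric])
qed

lemma M0_subset_Vvar: "M0 n \<subseteq> Vvar n"
  by (auto simp: Vvar_def)

lemma M0_torus: "p \<in> M0 n \<Longrightarrow> e \<in> pairs n \<Longrightarrow> p e \<noteq> 0"
  by (simp add: M0_def)

lemma Wpairs_subset_pairs: "Wpairs n \<subseteq> pairs n"
  by (auto simp: Wpairs_def pairs_def)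

text \<open>
  On the torus of \<open>W\<close>, passing to the closure of the moduli space does not change the ideal.
\<close>

lemma V_ideal_iff:
  "f \<in> V_ideal n \<longleftrightarrow> f \<in> carrier (laurent_ring (Wpairs n)) \<and> (\<forall>p\<in>M0 n. leval p f = 0)"
proof
  assume "f \<in> V_ideal n"
  moreover have "\<forall>e\<in>Wpairs n. p e \<noteq> 0" if "p \<in> M0 n" for p
    using M0_torus[OF that] Wpairs_subset_pairs by blast
  ultimately show "f \<in> carrier (laurent_ring (Wpairs n)) \<and> (\<forall>p\<in>M0 n. leval p f = 0)"
    using M0_subset_Vvar[of n] unfolding V_ideal_def by blast
next
  assume f: "f \<in> carrier (laurent_ring (Wpairs n)) \<and> (\<forall>p\<in>M0 n. leval p f = 0)"
  then obtain d g where d: "keys d \<subseteq> Wpairs n" and g: "g \<in> carrier (poly_ring (Wpairs n))"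
    and dg: "laurent_of_poly g = single (int_monom d) 1 * f"
    using clear_denominators by metis
  have d': "single (int_monom d) 1 \<in> carrier (laurent_ring (Wpairs n))"
    using d by (simp add: carrier_laurent_ring)
  have g_eval: "peval p g = monom_eval p (int_monom d) * leval p f"
    if "\<And>e. e \<in> Wpairs n \<Longrightarrow> p e \<noteq> 0" for p
    using leval_mult[OF d' _ that, of f] f by (simp add: peval_eq_leval dg leval_single)
  let ?Z = "{p \<in> Wspace n. \<forall>h\<in>{g}. peval p h = 0}"
  have "W_closed n ?Z"
    unfolding W_closed_def using g by (intro exI[of _ "{g}"]) auto
  moreover have "M0 n \<subseteq> ?Z"
  proof
    fix p assume p: "p \<in> M0 n"
    then have "peval p g = monom_eval p (int_monom d) * leval p f"
      using M0_torus[OF p] Wpairs_subset_pairs by (intro g_eval) blast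
    with p f show "p \<in> ?Z" by (simp add: M0_def)
  qed
  ultimately have Z: "Vvar n \<subseteq> ?Z"
    by (auto simp: Vvar_def)
  have "leval p f = 0" if "p \<in> Vvar n" "\<forall>e\<in>Wpairs n. p e \<noteq> 0" for p
  proof -
    have "monom_eval p (int_monom d) \<noteq> 0"
      by (rule monom_eval_nonzero) (use d that(2) in auto)
    moreover have "monom_eval p (int_monom d) * leval p f = 0"
      using Z that g_eval[of p] by auto
    ultimately show ?thesis by simp
  qed
  with f show "f \<in> V_ideal n"
    by (simp add: V_ideal_def)
qed

section \<open>Pulling back along the parametrization\<close>

lemma psi_subst_superset:
  assumes "finite K" "keys f \<subseteq> K"
  shows "psi_subst n f = (\<Sum>m\<in>K. single 0 (lookup f m) *
     (\<Prod>\<sigma>\<in>keys m. \<Prod>i\<in>{1..n}.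
        W_coord_pow n (\<sigma> i) (\<sigma> (cyc_next n i)) (- lookup m \<sigma>)))"
  unfolding psi_subst_def using assms
  by (intro sum.mono_neutral_left) (auto simp: in_keys_iff)

lemma psi_subst_add: "psi_subst n (f + g) = psi_subst n f + psi_subst n g"
proof -
  let ?K = "keys f \<union> keys g"
  have fin: "finite ?K" by simp
  have sub: "keys (f + g) \<subseteq> ?K" "keys f \<subseteq> ?K" "keys g \<subseteq> ?K"
    by (auto simp: Poly_Mapping.keys_add)
  show ?thesis
    unfolding psi_subst_superset[OF fin sub(1)] psi_subst_superset[OF fin sub(2)]
      psi_subst_superset[OF fin sub(3)]
    by (simp only: lookup_add single_add distrib_right sum.distrib)
qed

lemma psi_subst_in_laurent_ring: "psi_subst n f \<in> carrier (laurent_ring (Wpairs n))"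
proof -
  let ?M = "{m. keys m \<subseteq> Wpairs n} :: ((nat \<times> nat) \<Rightarrow>\<^sub>0 int) set"
  have M: "0 \<in> ?M" "a \<in> ?M \<Longrightarrow> b \<in> ?M \<Longrightarrow> a + b \<in> ?M" for a b
    using Poly_Mapping.keys_add[of a b] by auto
  have W: "keys (W_coord_pow n i j k) \<subseteq> ?M" for i j k
    by (auto simp: W_coord_pow_def split: if_splits)
  have P: "keys (\<Prod>\<sigma>\<in>S. \<Prod>i\<in>{1..n}. W_coord_pow n (a \<sigma> i) (b \<sigma> i) (k \<sigma>)) \<subseteq> ?M"
    for S :: "(nat \<Rightarrow> nat) set" and a b k
    by (intro keys_prod_subset M W)
  have summand: "keys (single 0 c * (\<Prod>\<sigma>\<in>S. \<Prod>i\<in>{1..n}. W_coord_pow n (a \<sigma> i) (b \<sigma> i) (k \<sigma>))) \<subseteq> ?M"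
    for S :: "(nat \<Rightarrow> nat) set" and a b k c
  proof
    fix x
    assume "x \<in> keys (single 0 c * (\<Prod>\<sigma>\<in>S. \<Prod>i\<in>{1..n}. W_coord_pow n (a \<sigma> i) (b \<sigma> i) (k \<sigma>)))"
    then obtain u w where "x = u + w" "u \<in> keys (single 0 c :: (nat \<times> nat) lpoly)"
      and w: "w \<in> keys (\<Prod>\<sigma>\<in>S. \<Prod>i\<in>{1..n}. W_coord_pow n (a \<sigma> i) (b \<sigma> i) (k \<sigma>))"
      using keys_mult by blast
    then have "x = w" by (simp split: if_splits)
    with P w show "x \<in> ?M" by blast
  qed
  have "keys (psi_subst n f) \<subseteq> ?M"
    unfolding psi_subst_def
    by (rule order_trans[OF Poly_Mapping.keys_sum]) (intro UN_least summand)
  then show ?thesis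
    by (auto simp: carrier_laurent_ring)
qed

lemma leval_phi_torus_ideal:
  assumes f: "f \<in> torus_ideal (Sigma_perms n) X" and p: "phi_defined n p"
    and X: "proj_point (phi n p) \<in> X"
  shows "leval (phi n p) f = 0"
proof -
  have "\<forall>\<sigma>\<in>Sigma_perms n. phi n p \<sigma> \<noteq> 0"
    using phi_nonzero[OF p] by blast
  with f X proj_point_refl[of "phi n p"] show ?thesis
    unfolding torus_ideal_def by blast
qed

text \<open>
  A function that vanishes on the toric variety pulls back to a Laurent polynomial that vanishes on
  the whole torus of \<open>W\<close>, hence to 0.
\<close>

lemma psi_subst_T_ideal:
  assumes n: "n \<ge> 3" and f: "f \<in> T_ideal n"
  shows "psi_subst n f = 0"
proof (rule laurent_eq_zeroI[OF psi_subst_in_laurent_ring])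
  fix v :: "nat \<times> nat \<Rightarrow> complex" assume v: "\<And>e. e \<in> Wpairs n \<Longrightarrow> v e \<noteq> 0"
  \<comment> \<open>the point of \<open>W\<close> with coordinates \<open>v\<close>\<close>
  define p where "p e = (if e \<in> Wpairs n then v e else if e \<in> pairs n then 1 else 0)" for e
  have p: "p \<in> Wspace n" "\<forall>e\<in>pairs n. p e \<noteq> 0"
    using n v by (auto simp: p_def Wspace_def vecs_def Wpairs_def pairs_def)
  then have dom: "phi_defined n p"
    using phi_defined_iff[OF n] by blast
  have "p (1, 2) = 1"
    using p(1) by (simp add: Wspace_def)
  then have "p \<noteq> (\<lambda>_. 0)"
    by auto
  then have "proj_point p \<in> proj_space (pairs n)"
    using p(1) by (auto simp: proj_space_def Wspace_def)
  then have "proj_point (phi n p) \<in> Tvar n"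
    unfolding Tvar_def by (intro subsetD[OF subset_proj_closure] phi_imageI dom)
  then have "leval (phi n p) f = 0"
    by (rule leval_phi_torus_ideal[OF f dom])
  moreover have "f \<in> carrier (z_ring n)"
    using f by (simp add: torus_ideal_def)
  ultimately have "leval p (psi_subst n f) = 0"
    using leval_psi_subst[OF n p] by simp
  moreover have "leval v (psi_subst n f) = leval p (psi_subst n f)"
    by (rule leval_cong)
      (use psi_subst_in_laurent_ring[of n f] in \<open>auto simp: carrier_laurent_ring p_def\<close>)
  ultimately show "leval v (psi_subst n f) = 0" by simp
qed

text \<open>
  Vanishing on the open Parke--Taylor variety can be tested on the moduli space inside the chart \<open>W\<close>.
\<close>

lemma torus_ideal_PT_open:
  assumes n: "n \<ge> 3"
  shows "torus_ideal (Sigma_perms n) (PT_open n) =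
    {f \<in> carrier (z_ring n). psi_subst n f \<in> V_ideal n}"
proof (intro equalityI subsetI)
  fix f assume f: "f \<in> torus_ideal (Sigma_perms n) (PT_open n)"
  then have carr: "f \<in> carrier (z_ring n)"
    by (simp add: torus_ideal_def)
  have "leval p (psi_subst n f) = 0" if p: "p \<in> M0 n" for p
  proof -
    have dom: "phi_defined n p"
      using p phi_defined_iff[OF n] by (simp add: M0_def)
    have "proj_point (phi n p) \<in> PT_open n"
      unfolding PT_open_def using p dom by (intro phi_imageI) (simp_all add: M0_def)
    then have "leval (phi n p) f = 0"
      by (rule leval_phi_torus_ideal[OF f dom])
    then show ?thesis
      using p leval_psi_subst[OF n _ _ carr] by (simp add: M0_def)
  qed
  then show "f \<in> {f \<in> carrier (z_ring n). psi_subst n f \<in> V_ideal n}"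
    using carr by (simp add: V_ideal_iff psi_subst_in_laurent_ring)
next
  fix f assume "f \<in> {f \<in> carrier (z_ring n). psi_subst n f \<in> V_ideal n}"
  then have carr: "f \<in> carrier (z_ring n)" and f: "\<And>p. p \<in> M0 n \<Longrightarrow> leval p (psi_subst n f) = 0"
    by (auto simp: V_ideal_iff)
  have "leval v f = 0" if P: "P \<in> PT_open n" "v \<in> P" for P v
  proof -
    from P obtain p Q c where Q: "Q \<in> Gr2 n" "p \<in> Q" "phi_defined n p"
      and c: "c \<noteq> 0" "v = (\<lambda>\<sigma>. c * phi n p \<sigma>)"
      by (auto simp: PT_open_def phi_image_def proj_point_def)
    obtain q b where q: "q \<in> M0 n" "b \<noteq> 0" "phi n q = (\<lambda>\<sigma>. b * phi n p \<sigma>)"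
      using Gr2_rescale_M0[OF n Q] by blast
    have "leval v f = leval (phi n p) f"
      unfolding c(2) by (rule leval_scale[OF carr c(1)])
    also have "\<dots> = leval (phi n q) f"
      unfolding q(3) by (rule leval_scale[OF carr q(2), symmetric])
    also have "\<dots> = leval q (psi_subst n f)"
      using q(1) leval_psi_subst[OF n _ _ carr] by (simp add: M0_def)
    also have "\<dots> = 0"
      using f q(1) by blast
    finally show ?thesis .
  qed
  with carr show "f \<in> torus_ideal (Sigma_perms n) (PT_open n)"
    unfolding torus_ideal_def by blast
qed

lemma psi_pullback_coset:
  assumes "n \<ge> 3"
  shows "psi_pullback n (T_ideal n +>\<^bsub>z_ring n\<^esub> f) = psi_subst n f"
proof -
  have "0 \<in> T_ideal n"
    using additive_subgroup.zero_closed[OF ideal.axioms(1)[OF ideal_torus_ideal]] by simp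
  then have "0 + f \<in> T_ideal n +>\<^bsub>z_ring n\<^esub> f"
    unfolding a_r_coset_def' by auto
  moreover have "psi_subst n g = psi_subst n f" if "g \<in> T_ideal n +>\<^bsub>z_ring n\<^esub> f" for g
  proof -
    from that obtain h where "h \<in> T_ideal n" "g = h + f"
      unfolding a_r_coset_def' by auto
    then show ?thesis
      by (simp add: psi_subst_add psi_subst_T_ideal[OF assms])
  qed
  ultimately have "psi_subst n ` (T_ideal n +>\<^bsub>z_ring n\<^esub> f) = {psi_subst n f}"
    unfolding add_0 by blast
  then show ?thesis
    by (simp add: psi_pullback_def)
qed

lemma lift_ideal_psi_star:
  assumes n: "n \<ge> 3"
  shows "lift_ideal (z_ring n) (T_ideal n) (psi_star n (V_ideal n)) =
    torus_ideal (Sigma_perms n) (PT_open n)"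
proof -
  interpret Z: cring "z_ring n" by (rule cring_torus_ring)
  have "T_ideal n +>\<^bsub>z_ring n\<^esub> f \<in> carrier (z_ring n Quot T_ideal n)"
    if "f \<in> carrier (z_ring n)" for f
    using that unfolding FactRing_def A_RCOSETS_def' by auto
  then have "{f \<in> carrier (z_ring n). T_ideal n +>\<^bsub>z_ring n\<^esub> f \<in> psi_star n (V_ideal n)} =
      {f \<in> carrier (z_ring n). psi_subst n f \<in> V_ideal n}"
    by (intro Collect_cong conj_cong refl) (simp add: psi_star_def psi_pullback_coset[OF n])
  moreover have "Idl\<^bsub>z_ring n\<^esub> torus_ideal (Sigma_perms n) (PT_open n) =
      torus_ideal (Sigma_perms n) (PT_open n)"
  proof (intro equalityI Z.genideal_minimal[OF ideal_torus_ideal] Z.genideal_self order_refl)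
    show "torus_ideal (Sigma_perms n) (PT_open n) \<subseteq> carrier (z_ring n)"
      unfolding torus_ideal_def by blast
  qed
  ultimately show ?thesis
    by (simp only: lift_ideal_def torus_ideal_PT_open[OF n])
qed

lemma ideal_set_add_absorb:
  assumes I: "ideal I R" and J: "ideal J R" and sub: "I \<subseteq> J"
  shows "I <+>\<^bsub>R\<^esub> J = J"
proof (intro equalityI subsetI)
  interpret J: ideal J R by (rule J)
  fix x
  show "x \<in> J" if "x \<in> I <+>\<^bsub>R\<^esub> J"
  proof -
    from that obtain h k where h: "h \<in> I" and k: "k \<in> J" and x: "x = h \<oplus>\<^bsub>R\<^esub> k"
      unfolding set_add_def' by auto
    show ?thesis
      unfolding x
      by (rule additive_subgroup.a_closed[OF ideal.axioms(1)[OF J] subsetD[OF sub h] k])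
  qed
  show "x \<in> I <+>\<^bsub>R\<^esub> J" if "x \<in> J"
  proof -
    have "x = \<zero>\<^bsub>R\<^esub> \<oplus>\<^bsub>R\<^esub> x"
      by (rule J.l_zero[symmetric]) (rule J.Icarr[OF that])
    moreover have "\<zero>\<^bsub>R\<^esub> \<in> I"
      by (rule additive_subgroup.zero_closed[OF ideal.axioms(1)[OF I]])
    ultimately show ?thesis
      using that unfolding set_add_def' UN_iff by (metis singletonI)
  qed
qed

section \<open>The ideals of the open and of the closed Parke--Taylor variety\<close>

theorem theorem5p1:
  fixes n :: nat
  assumes "n \<ge> 3"
  shows "torus_ideal (Sigma_perms n) (PT_open n) =
           torus_ideal (Sigma_perms n) (Tvar n)
             <+>\<^bsub>torus_ring (Sigma_perms n)\<^esub>
           lift_ideal (torus_ring (Sigma_perms n)) (torus_ideal (Sigma_perms n) (Tvar n))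
             (psi_star n (V_ideal n))
         \<and> vanishing_ideal (Sigma_perms n) (PT n) =
           saturation (poly_ring (Sigma_perms n))
             (num_ideal (Sigma_perms n) (torus_ideal (Sigma_perms n) (PT_open n)))
             (\<Prod>\<sigma>\<in>Sigma_perms n. pvar \<sigma>)"
proof
  have "T_ideal n \<subseteq> torus_ideal (Sigma_perms n) (PT_open n)"
    using PT_open_subset_Tvar[of n] unfolding torus_ideal_def by blast
  then show "torus_ideal (Sigma_perms n) (PT_open n) = T_ideal n <+>\<^bsub>z_ring n\<^esub>
      lift_ideal (z_ring n) (T_ideal n) (psi_star n (V_ideal n))"
    unfolding lift_ideal_psi_star[OF assms]
    by (intro ideal_set_add_absorb[symmetric] ideal_torus_ideal)
  show "vanishing_ideal (Sigma_perms n) (PT n) =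
      saturation (poly_ring (Sigma_perms n))
        (num_ideal (Sigma_perms n) (torus_ideal (Sigma_perms n) (PT_open n)))
        (\<Prod>\<sigma>\<in>Sigma_perms n. pvar \<sigma>)"
    unfolding PT_def PT_open_def
    using finite_Sigma_perms id_in_Sigma_perms phi_image_subset_proj_space
    by (rule vanishing_ideal_proj_closure_eq_saturation) (rule phi_image_torus)
qed

end
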